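(* Let $\mathbf{x}:U\to\mathbb{R}^3$ be a wavefront, $\Omega$ a tangent moving basis of $\mathbf{x}$, and $\mathbf{p}\in\Sigma(\mathbf{x})$ with $\mathrm{rank}(D\mathbf{x}(\mathbf{p}))=1$, $K_\Omega(\mathbf{p})\neq0$ and $H_\Omega(\mathbf{p})<0$ (resp. $H_\Omega(\mathbf{p})>0$). Then the following statements are equivalent: (1) $\mathbf{x}$ is parallelly smoothable at $\mathbf{p}$. (2) $\lim_{(u,v)\to\mathbf{p}}H=+\infty$ or $\lim_{(u,v)\to\mathbf{p}}H=-\infty$. (3) $\lim_{(u,v)\to\mathbf{p}}k_1=+\infty$ or $\lim_{(u,v)\to\mathbf{p}}k_1=-\infty$ (resp. the same with $k_2$ in place of $k_1$). (4) $\lim_{(u,v)\to\mathbf{p}}K=+\infty$ or $\lim_{(u,v)\to\mathbf{p}}K=-\infty$. (5) There exists an open neighborhood $V$ of $\mathbf{p}$ on which $\lambda_\Omega$ does not change sign. (6) There exists an open neighborhood $V$ of $\mathbf{p}$ on which $k_{2\Omega}$ (resp. $k_{1\Omega}$) does not change sign.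
   Context: All maps are $C^\infty$; $U\subset\mathbb{R}^2$ is open, with coordinates $(u,v)$. A smooth map $\mathbf{x}:U\to\mathbb{R}^3$ is a frontal if every $\mathbf{p}\in U$ has an open neighborhood $V_p\subset U$ with a smooth unit vector field $\mathbf{n}_p:V_p\to\mathbb{R}^3$ orthogonal to $\mathbf{x}_u,\mathbf{x}_v$; it is a wavefront (front) if moreover each $(\mathbf{x},\mathbf{n}_p)$ is an immersion into $\mathbb{R}^3\times S^2$. The singular set is $\Sigma(\mathbf{x})=\{\mathbf{p}\in U:\mathbf{x}\text{ is not immersive at }\mathbf{p}\}$. A tangent moving basis (tmb) of $\mathbf{x}$ is a smooth map $\Omega=(\mathbf{w}_1\ \mathbf{w}_2):U\to\mathcal{M}_{3\times2}(\mathbb{R})$ with linearly independent columns at each point and $\mathbf{x}_u,\mathbf{x}_v\in\mathrm{span}(\mathbf{w}_1,\mathbf{w}_2)$. Put $\mathbf{n}=\frac{\mathbf{w}_1\times\mathbf{w}_2}{\|\mathbf{w}_1\times\mathbf{w}_2\|}$, $\mathbf{I}_\Omega=\Omega^T\Omega$, $\mathbf{II}_\Omega=-\Omega^TD\mathbf{n}$, $\mu_\Omega=-\mathbf{II}_\Omega^T\mathbf{I}_\Omega^{-1}$, $\Lambda_\Omega=D\mathbf{x}^T\Omega\,\mathbf{I}_\Omega^{-1}$, $\lambda_\Omega=\det\Lambda_\Omega$, $K_\Omega=\det\mu_\Omega$, $H_\Omega=-\frac12\mathrm{tr}(\mu_\Omega\,\mathrm{adj}(\Lambda_\Omega))$.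 One has $D\mathbf{x}=\Omega\Lambda_\Omega^T$ and $D\mathbf{n}=\Omega\mu_\Omega^T$, so $\Sigma(\mathbf{x})=\lambda_\Omega^{-1}(0)$. The fundamental forms are $\begin{pmatrix} E & F \\ F & G \end{pmatrix}=D\mathbf{x}^TD\mathbf{x}$ and $\begin{pmatrix} e & f \\ f & g \end{pmatrix}=-D\mathbf{x}^TD\mathbf{n}$ on $U$; on $U\setminus\Sigma(\mathbf{x})$, $K=\frac{eg-f^2}{EG-F^2}$ and $H=\frac{eG+gE-2fF}{2(EG-F^2)}$ are the Gaussian and mean curvatures. The relative principal curvatures are $k_{1\Omega}=H_\Omega-\sqrt{H_\Omega^2-\lambda_\Omega K_\Omega}$ and $k_{2\Omega}=H_\Omega+\sqrt{H_\Omega^2-\lambda_\Omega K_\Omega}$ on $U$. On $U\setminus\Sigma(\mathbf{x})$: $k_1=H-\sqrt{H^2-K}$ and $k_2=H+\sqrt{H^2-K}$ where $\lambda_\Omega>0$; $k_1=H+\sqrt{H^2-K}$ and $k_2=H-\sqrt{H^2-K}$ where $\lambda_\Omega<0$. $\mathbf{x}$ is parallelly smoothable at $\mathbf{p}\in\Sigma(\mathbf{x})$ if there exist $\epsilon>0$ and an open neighborhood $V$ of $\mathbf{p}$ such that $\mathrm{rank}(D(\mathbf{x}+l\mathbf{n})(\mathbf{q}))=2$ for every $(\mathbf{q},l)\in V\times(0,\epsilon)$, or for every $(\mathbf{q},l)\in V\times(-\epsilon,0)$. Conventions: a function does not change sign on $V$ if it is $\ge0$ on all of $V$ or $\le0$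 on all of $V$. Limits of $K,H,k_1,k_2$ are taken along $U\setminus\Sigma(\mathbf{x})$: $\lim_{(u,v)\to\mathbf{p}}\varphi=+\infty$ (resp. $-\infty$) means that for every $M>0$ there is a neighborhood $N$ of $\mathbf{p}$ with $\varphi>M$ (resp. $\varphi<-M$) on $N\setminus\Sigma(\mathbf{x})$. *)

theory Defs
  imports "HOL-Analysis.Analysis"
begin

section \<open>Smooth maps on open sets\<close>

text \<open>
  Class \<open>C^k\<close> on an open set of a Euclidean space: \<open>f\<close> is \<open>C^(k+1)\<close> iff it is differentiable and
  all its directional derivatives are \<open>C^k\<close>.  Both predicates are only meant for open \<open>S\<close>.
\<close>

primrec Ck_on :: "nat \<Rightarrow> ('a::euclidean_space \<Rightarrow> 'b::real_normed_vector) \<Rightarrow> 'a set \<Rightarrow> bool" where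
  "Ck_on 0 f S \<longleftrightarrow> continuous_on S f"
| "Ck_on (Suc k) f S \<longleftrightarrow>
     (\<forall>x\<in>S. f differentiable (at x)) \<and>
     (\<forall>v. Ck_on k (\<lambda>x. frechet_derivative f (at x) v) S)"

definition smooth_on :: "'a set \<Rightarrow> ('a::euclidean_space \<Rightarrow> 'b::real_normed_vector) \<Rightarrow> bool" where
  "smooth_on S f \<longleftrightarrow> (\<forall>k. Ck_on k f S)"

definition immersive_at :: "('a::real_normed_vector \<Rightarrow> 'b::real_normed_vector) \<Rightarrow> 'a \<Rightarrow> bool" where
  "immersive_at f p \<longleftrightarrow> f differentiable (at p) \<and> inj (frechet_derivative f (at p))"

section \<open>Frontals and wavefronts\<close>

text \<open>
  The columns of the \<open>3\<times>2\<close> matrix \<open>Dmat f p\<close> are the partial derivatives \<open>f\<^sub>u\<close> and \<open>f\<^sub>v\<close> at \<open>p\<close>.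
\<close>

abbreviation Dmat :: "(real^2 \<Rightarrow> real^3) \<Rightarrow> real^2 \<Rightarrow> real^2^3" where
  "Dmat f p \<equiv> jacobian f (at p)"

definition singular_set :: "(real^2) set \<Rightarrow> (real^2 \<Rightarrow> real^3) \<Rightarrow> (real^2) set" where
  "singular_set U x = {p \<in> U. \<not> immersive_at x p}"

definition unit_normal_field_on ::
    "(real^2) set \<Rightarrow> (real^2 \<Rightarrow> real^3) \<Rightarrow> (real^2 \<Rightarrow> real^3) \<Rightarrow> bool" where
  "unit_normal_field_on V x n \<longleftrightarrow>
     smooth_on V n \<and>
     (\<forall>q\<in>V. norm (n q) = 1 \<and>
        n q \<bullet> column 1 (Dmat x q) = 0 \<and> n q \<bullet> column 2 (Dmat x q) = 0)"

definition frontal :: "(real^2) set \<Rightarrow> (real^2 \<Rightarrow> real^3) \<Rightarrow> bool" where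
  "frontal U x \<longleftrightarrow>
     smooth_on U x \<and>
     (\<forall>p\<in>U. \<exists>V n. open V \<and> p \<in> V \<and> V \<subseteq> U \<and> unit_normal_field_on V x n)"

text \<open>
  As the second component of \<open>(x, n)\<close> takes values in the unit sphere, an embedded submanifold,
  being an immersion into \<open>\<real>\<^sup>3 \<times> S\<^sup>2\<close> is the same as being an immersion into \<open>\<real>\<^sup>3 \<times> \<real>\<^sup>3\<close>.
\<close>

definition wavefront :: "(real^2) set \<Rightarrow> (real^2 \<Rightarrow> real^3) \<Rightarrow> bool" where
  "wavefront U x \<longleftrightarrow>
     frontal U x \<and>
     (\<forall>p\<in>U. \<exists>V n. open V \<and> p \<in> V \<and> V \<subseteq> U \<and> unit_normal_field_on V x n \<and>
        (\<forall>q\<in>V. immersive_at (\<lambda>r. (x r, n r)) q))"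

section \<open>Tangent moving bases\<close>

text \<open>
  A pair \<open>(w\<^sub>1 w\<^sub>2)\<close> is a \<open>3\<times>2\<close> matrix with columns \<open>w\<^sub>1, w\<^sub>2\<close>.  The inequality of the columns is
  needed because \<^const>\<open>independent\<close> is about the \<^emph>\<open>set\<close> of columns.
\<close>

definition tangent_moving_basis ::
    "(real^2) set \<Rightarrow> (real^2 \<Rightarrow> real^3) \<Rightarrow> (real^2 \<Rightarrow> real^2^3) \<Rightarrow> bool" where
  "tangent_moving_basis U x \<Omega> \<longleftrightarrow>
     smooth_on U \<Omega> \<and>
     (\<forall>q\<in>U. column 1 (\<Omega> q) \<noteq> column 2 (\<Omega> q) \<and>
        independent {column 1 (\<Omega> q), column 2 (\<Omega> q)} \<and>
        column 1 (Dmat x q) \<in> span {column 1 (\<Omega> q), column 2 (\<Omega> q)} \<and>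
        column 2 (Dmat x q) \<in> span {column 1 (\<Omega> q), column 2 (\<Omega> q)})"

definition tmb_normal :: "(real^2 \<Rightarrow> real^2^3) \<Rightarrow> real^2 \<Rightarrow> real^3" where
  "tmb_normal \<Omega> q =
     (let w = cross3 (column 1 (\<Omega> q)) (column 2 (\<Omega> q)) in w /\<^sub>R norm w)"

definition I_rel :: "(real^2 \<Rightarrow> real^2^3) \<Rightarrow> real^2 \<Rightarrow> real^2^2" where
  "I_rel \<Omega> q = transpose (\<Omega> q) ** \<Omega> q"

definition II_rel :: "(real^2 \<Rightarrow> real^2^3) \<Rightarrow> real^2 \<Rightarrow> real^2^2" where
  "II_rel \<Omega> q = - (transpose (\<Omega> q) ** Dmat (tmb_normal \<Omega>) q)"

definition mu_rel :: "(real^2 \<Rightarrow> real^2^3) \<Rightarrow> real^2 \<Rightarrow> real^2^2" where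
  "mu_rel \<Omega> q = - (transpose (II_rel \<Omega> q) ** matrix_inv (I_rel \<Omega> q))"

definition Lambda_rel ::
    "(real^2 \<Rightarrow> real^3) \<Rightarrow> (real^2 \<Rightarrow> real^2^3) \<Rightarrow> real^2 \<Rightarrow> real^2^2" where
  "Lambda_rel x \<Omega> q = transpose (Dmat x q) ** \<Omega> q ** matrix_inv (I_rel \<Omega> q)"

definition lambda_rel ::
    "(real^2 \<Rightarrow> real^3) \<Rightarrow> (real^2 \<Rightarrow> real^2^3) \<Rightarrow> real^2 \<Rightarrow> real" where
  "lambda_rel x \<Omega> q = det (Lambda_rel x \<Omega> q)"

definition adj2 :: "real^2^2 \<Rightarrow> real^2^2" where
  "adj2 A = vector [vector [A$2$2, - (A$1$2)], vector [- (A$2$1), A$1$1]]"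

definition K_rel :: "(real^2 \<Rightarrow> real^2^3) \<Rightarrow> real^2 \<Rightarrow> real" where
  "K_rel \<Omega> q = det (mu_rel \<Omega> q)"

definition H_rel ::
    "(real^2 \<Rightarrow> real^3) \<Rightarrow> (real^2 \<Rightarrow> real^2^3) \<Rightarrow> real^2 \<Rightarrow> real" where
  "H_rel x \<Omega> q = - (1/2) * trace (mu_rel \<Omega> q ** adj2 (Lambda_rel x \<Omega> q))"

definition k1_rel ::
    "(real^2 \<Rightarrow> real^3) \<Rightarrow> (real^2 \<Rightarrow> real^2^3) \<Rightarrow> real^2 \<Rightarrow> real" where
  "k1_rel x \<Omega> q =
     H_rel x \<Omega> q - sqrt ((H_rel x \<Omega> q)\<^sup>2 - lambda_rel x \<Omega> q * K_rel \<Omega> q)"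

definition k2_rel ::
    "(real^2 \<Rightarrow> real^3) \<Rightarrow> (real^2 \<Rightarrow> real^2^3) \<Rightarrow> real^2 \<Rightarrow> real" where
  "k2_rel x \<Omega> q =
     H_rel x \<Omega> q + sqrt ((H_rel x \<Omega> q)\<^sup>2 - lambda_rel x \<Omega> q * K_rel \<Omega> q)"

section \<open>Classical curvatures\<close>

text \<open>
  As \<open>E G - F\<^sup>2\<close> vanishes on the singular set, these are meaningful only off that set.  The
  second fundamental form is a symmetric matrix whenever \<open>\<Omega>\<close> is a tangent moving basis of \<open>x\<close>;
  \<open>f\<close> is read off from its upper right entry.
\<close>

definition fundI :: "(real^2 \<Rightarrow> real^3) \<Rightarrow> real^2 \<Rightarrow> real^2^2" where
  "fundI x q = transpose (Dmat x q) ** Dmat x q"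

definition fundII ::
    "(real^2 \<Rightarrow> real^3) \<Rightarrow> (real^2 \<Rightarrow> real^2^3) \<Rightarrow> real^2 \<Rightarrow> real^2^2" where
  "fundII x \<Omega> q = - (transpose (Dmat x q) ** Dmat (tmb_normal \<Omega>) q)"

definition gauss_curv ::
    "(real^2 \<Rightarrow> real^3) \<Rightarrow> (real^2 \<Rightarrow> real^2^3) \<Rightarrow> real^2 \<Rightarrow> real" where
  "gauss_curv x \<Omega> q =
     (let E = fundI x q $ 1 $ 1; F = fundI x q $ 1 $ 2; G = fundI x q $ 2 $ 2;
          e = fundII x \<Omega> q $ 1 $ 1; f = fundII x \<Omega> q $ 1 $ 2; g = fundII x \<Omega> q $ 2 $ 2
      in (e * g - f\<^sup>2) / (E * G - F\<^sup>2))"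

definition mean_curv ::
    "(real^2 \<Rightarrow> real^3) \<Rightarrow> (real^2 \<Rightarrow> real^2^3) \<Rightarrow> real^2 \<Rightarrow> real" where
  "mean_curv x \<Omega> q =
     (let E = fundI x q $ 1 $ 1; F = fundI x q $ 1 $ 2; G = fundI x q $ 2 $ 2;
          e = fundII x \<Omega> q $ 1 $ 1; f = fundII x \<Omega> q $ 1 $ 2; g = fundII x \<Omega> q $ 2 $ 2
      in (e * G + g * E - 2 * f * F) / (2 * (E * G - F\<^sup>2)))"

definition k1 :: "(real^2 \<Rightarrow> real^3) \<Rightarrow> (real^2 \<Rightarrow> real^2^3) \<Rightarrow> real^2 \<Rightarrow> real" where
  "k1 x \<Omega> q =
     (let H = mean_curv x \<Omega> q; K = gauss_curv x \<Omega> q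
      in if lambda_rel x \<Omega> q > 0 then H - sqrt (H\<^sup>2 - K) else H + sqrt (H\<^sup>2 - K))"

definition k2 :: "(real^2 \<Rightarrow> real^3) \<Rightarrow> (real^2 \<Rightarrow> real^2^3) \<Rightarrow> real^2 \<Rightarrow> real" where
  "k2 x \<Omega> q =
     (let H = mean_curv x \<Omega> q; K = gauss_curv x \<Omega> q
      in if lambda_rel x \<Omega> q > 0 then H + sqrt (H\<^sup>2 - K) else H - sqrt (H\<^sup>2 - K))"

section \<open>The properties compared in the theorem\<close>

definition parallelly_smoothable_at ::
    "(real^2) set \<Rightarrow> (real^2 \<Rightarrow> real^3) \<Rightarrow> (real^2 \<Rightarrow> real^2^3) \<Rightarrow> real^2 \<Rightarrow> bool" where
  "parallelly_smoothable_at U x \<Omega> p \<longleftrightarrow>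
     p \<in> singular_set U x \<and>
     (\<exists>\<epsilon>>0. \<exists>V. open V \<and> p \<in> V \<and> V \<subseteq> U \<and>
        ((\<forall>q\<in>V. \<forall>l\<in>{0<..<\<epsilon>}. rank (Dmat (\<lambda>r. x r + l *\<^sub>R tmb_normal \<Omega> r) q) = 2) \<or>
         (\<forall>q\<in>V. \<forall>l\<in>{-\<epsilon><..<0}. rank (Dmat (\<lambda>r. x r + l *\<^sub>R tmb_normal \<Omega> r) q) = 2)))"

text \<open>
  Limits are taken along \<open>U - singular_set U x\<close>.  If \<open>p\<close> is not in the closure of that set, the
  filter is trivial and both limits hold vacuously.
\<close>

definition diverges_at ::
    "(real^2) set \<Rightarrow> (real^2 \<Rightarrow> real^3) \<Rightarrow> real^2 \<Rightarrow> (real^2 \<Rightarrow> real) \<Rightarrow> bool" where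
  "diverges_at U x p \<phi> \<longleftrightarrow>
     filterlim \<phi> at_top (at p within (U - singular_set U x)) \<or>
     filterlim \<phi> at_bot (at p within (U - singular_set U x))"

definition no_sign_change_on :: "(real^2) set \<Rightarrow> (real^2 \<Rightarrow> real) \<Rightarrow> bool" where
  "no_sign_change_on V \<phi> \<longleftrightarrow> (\<forall>q\<in>V. \<phi> q \<ge> 0) \<or> (\<forall>q\<in>V. \<phi> q \<le> 0)"

definition no_sign_change_near ::
    "(real^2) set \<Rightarrow> real^2 \<Rightarrow> (real^2 \<Rightarrow> real) \<Rightarrow> bool" where
  "no_sign_change_near U p \<phi> \<longleftrightarrow>
     (\<exists>V. open V \<and> p \<in> V \<and> V \<subseteq> U \<and> no_sign_change_on V \<phi>)"

definition all_equivalent :: "bool list \<Rightarrow> bool" where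
  "all_equivalent Ps \<longleftrightarrow> (\<forall>P\<in>set Ps. \<forall>Q\<in>set Ps. P \<longleftrightarrow> Q)"

end

theory Submission
  imports Defs
begin

text \<open>
  Off the singular set the curvatures are quotients by \<open>\<lambda>\<^sub>\<Omega>\<close>: \<open>H = H\<^sub>\<Omega> / \<lambda>\<^sub>\<Omega>\<close>, \<open>K = K\<^sub>\<Omega> / \<lambda>\<^sub>\<Omega>\<close> and
  \<open>k\<^sub>i = k\<^sub>i\<^sub>\<Omega> / \<lambda>\<^sub>\<Omega>\<close>.  The relevant numerators are continuous and nonzero at \<open>p\<close> while
  \<open>\<lambda>\<^sub>\<Omega>\<close> vanishes exactly on the singular set, so such a quotient diverges iff \<open>\<lambda>\<^sub>\<Omega>\<close> keeps its
  sign near \<open>p\<close>.  The remaining relative principal curvature is \<open>\<lambda>\<^sub>\<Omega>\<close> times a nonvanishing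
  continuous function, because \<open>k\<^sub>1\<^sub>\<Omega> k\<^sub>2\<^sub>\<Omega> = \<lambda>\<^sub>\<Omega> K\<^sub>\<Omega>\<close>.  Finally \<open>x + l n\<close> is singular at \<open>q\<close> iff
  \<open>\<lambda>\<^sub>\<Omega> - 2 l H\<^sub>\<Omega> + l\<^sup>2 K\<^sub>\<Omega>\<close> vanishes there; as \<open>H\<^sub>\<Omega>(p) \<noteq> 0\<close>, this polynomial has no small zero \<open>l\<close> of
  a given sign for all \<open>q\<close> near \<open>p\<close> iff \<open>\<lambda>\<^sub>\<Omega>\<close> does not take the sign opposite to that
  of \<open>- l H\<^sub>\<Omega>\<close>, by the intermediate value theorem.
\<close>

section \<open>Second derivatives and continuously differentiable maps\<close>

text \<open>The mixed difference is \<open>g t - g 0\<close> for the increment \<open>g\<close> of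
  \<open>f\<close> along \<open>v\<close>. The mean value theorem along \<open>u\<close> turns it
  into an increment of \<open>f' _ u\<close> along \<open>v\<close>, and a second application, along
  \<open>v\<close>, produces \<open>A\<close>.\<close>

lemma mixed_difference_mvt:
  fixes f :: "'a::real_normed_vector \<Rightarrow> real"
  assumes "t > 0"
    and sub: "\<And>r s. \<lbrakk>0 \<le> r; r \<le> t; 0 \<le> s; s \<le> t\<rbrakk> \<Longrightarrow> p + r *\<^sub>R u + s *\<^sub>R v \<in> S"
    and f': "\<And>y. y \<in> S \<Longrightarrow> (f has_derivative f' y) (at y)"
    and A: "\<And>y. y \<in> S \<Longrightarrow> ((\<lambda>z. f' z u) has_derivative A y) (at y)"
  shows "\<exists>r s. 0 \<le> r \<and> r \<le> t \<and> 0 \<le> s \<and> s \<le> t \<and>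
    f (p + t *\<^sub>R u + t *\<^sub>R v) - f (p + t *\<^sub>R u) - (f (p + t *\<^sub>R v) - f p)
      = t\<^sup>2 * A (p + r *\<^sub>R u + s *\<^sub>R v) v"
proof -
  define g where "g r = f (p + r *\<^sub>R u + t *\<^sub>R v) - f (p + r *\<^sub>R u)" for r
  have der_f: "((\<lambda>r. f (p + r *\<^sub>R u + s *\<^sub>R v)) has_real_derivative f' (p + r *\<^sub>R u + s *\<^sub>R v) u) (at r)"
    if "0 \<le> r" "r \<le> t" "0 \<le> s" "s \<le> t" for r s
  proof -
    have inS: "p + r *\<^sub>R u + s *\<^sub>R v \<in> S" using sub that by blast
    have "((\<lambda>r. f (p + r *\<^sub>R u + s *\<^sub>R v)) has_derivative (\<lambda>h. f' (p + r *\<^sub>R u + s *\<^sub>R v) (h *\<^sub>R u))) (at r)"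
      by (rule has_derivative_compose[where f="\<lambda>r. p + r *\<^sub>R u + s *\<^sub>R v" and g=f, OF _ f'[OF inS]]) (auto intro!: derivative_eq_intros)
    then show ?thesis
      using linear_scale[OF has_derivative_linear[OF f'[OF inS]]]
      by (simp add: has_field_derivative_def mult_commute_abs)
  qed
  have "(g has_real_derivative f' (p + r *\<^sub>R u + t *\<^sub>R v) u - f' (p + r *\<^sub>R u) u) (at r)"
    if "0 \<le> r" "r \<le> t" for r
    unfolding g_def using der_f[of r t] der_f[of r 0] that \<open>t > 0\<close>
    by (auto intro!: DERIV_diff)
  from MVT2[OF \<open>t > 0\<close> this] obtain r where r: "0 < r" "r < t"
    and gr: "g t - g 0 = t * (f' (p + r *\<^sub>R u + t *\<^sub>R v) u - f' (p + r *\<^sub>R u) u)"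
    by auto
  have "((\<lambda>s. f' (p + r *\<^sub>R u + s *\<^sub>R v) u) has_real_derivative A (p + r *\<^sub>R u + s *\<^sub>R v) v) (at s)"
    if "0 \<le> s" "s \<le> t" for s
  proof -
    have inS: "p + r *\<^sub>R u + s *\<^sub>R v \<in> S" using sub that r by simp
    have "((\<lambda>s. f' (p + r *\<^sub>R u + s *\<^sub>R v) u) has_derivative (\<lambda>h. A (p + r *\<^sub>R u + s *\<^sub>R v) (h *\<^sub>R v))) (at s)"
      by (rule has_derivative_compose[where f="\<lambda>s. p + r *\<^sub>R u + s *\<^sub>R v" and g="\<lambda>y. f' y u", OF _ A[OF inS]]) (auto intro!: derivative_eq_intros)
    then show ?thesis
      using linear_scale[OF has_derivative_linear[OF A[OF inS]]]
      by (simp add: has_field_derivative_def mult_commute_abs)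
  qed
  from MVT2[OF \<open>t > 0\<close> this] obtain s where s: "0 < s" "s < t"
    and fs: "f' (p + r *\<^sub>R u + t *\<^sub>R v) u - f' (p + r *\<^sub>R u) u = t * A (p + r *\<^sub>R u + s *\<^sub>R v) v"
    by auto
  show ?thesis
    by (rule exI[of _ r], rule exI[of _ s])
       (use r s gr fs in \<open>auto simp: g_def power2_eq_square\<close>)
qed

text \<open>The mixed difference is symmetric in \<open>u\<close> and \<open>v\<close>. Hence
  \<open>A _ v\<close> and \<open>B _ u\<close> agree at two, possibly different, points of an
  arbitrarily small parallelogram at \<open>p\<close>, and continuity carries both values to
  \<open>p\<close>.\<close>

lemma second_derivative_symmetric_real:
  fixes f :: "'a::real_normed_vector \<Rightarrow> real"
  assumes "open S" "p \<in> S"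
    and f': "\<And>y. y \<in> S \<Longrightarrow> (f has_derivative f' y) (at y)"
    and A: "\<And>y. y \<in> S \<Longrightarrow> ((\<lambda>z. f' z u) has_derivative A y) (at y)"
    and B: "\<And>y. y \<in> S \<Longrightarrow> ((\<lambda>z. f' z v) has_derivative B y) (at y)"
    and cA: "continuous_on S (\<lambda>y. A y v)" and cB: "continuous_on S (\<lambda>y. B y u)"
  shows "A p v = B p u"
proof -
  have "\<bar>A p v - B p u\<bar> \<le> e" if "e > 0" for e
  proof -
    have "isCont (\<lambda>y. A y v) p" "isCont (\<lambda>y. B y u) p"
      using cA cB \<open>open S\<close> \<open>p \<in> S\<close> by (auto simp: continuous_on_eq_continuous_at)
    then have lim: "((\<lambda>y. A y v) \<longlongrightarrow> A p v) (nhds p)" "((\<lambda>y. B y u) \<longlongrightarrow> B p u) (nhds p)"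
      by (simp_all add: isCont_def tendsto_nhds_iff)
    have "\<forall>\<^sub>F y in nhds p. y \<in> S \<and> dist (A y v) (A p v) < e/2 \<and> dist (B y u) (B p u) < e/2"
      using that lim[THEN tendstoD, of "e/2"] eventually_nhds_in_open[OF \<open>open S\<close> \<open>p \<in> S\<close>]
      by (auto intro: eventually_conj)
    then obtain d where "d > 0" and d: "\<And>y. dist y p < d \<Longrightarrow>
        y \<in> S \<and> dist (A y v) (A p v) < e/2 \<and> dist (B y u) (B p u) < e/2"
      unfolding eventually_nhds_metric by blast
    \<comment> \<open>Small enough for the parallelogram spanned at \<open>p\<close> by
      \<open>t\<close> times \<open>u\<close> and \<open>v\<close> to stay in the ball of radius
      \<open>d\<close>; the summand 1 avoids division by zero when both vectors vanish.\<close>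
    define t where "t = d / (norm u + norm v + 1)"
    have pos: "norm u + norm v + 1 > 0" by (smt (verit) norm_ge_zero)
    then have "t > 0" using \<open>d > 0\<close> by (simp add: t_def)
    have "t * (norm u + norm v) < d"
      using pos \<open>d > 0\<close> by (simp add: t_def field_simps)
    have near: "dist (p + r *\<^sub>R u + s *\<^sub>R v) p < d" if "0 \<le> r" "r \<le> t" "0 \<le> s" "s \<le> t" for r s
    proof -
      have "dist (p + r *\<^sub>R u + s *\<^sub>R v) p \<le> r * norm u + s * norm v"
        using that norm_triangle_ineq[of "r *\<^sub>R u" "s *\<^sub>R v"] by (simp add: dist_norm add.assoc)
      also have "\<dots> \<le> t * norm u + t * norm v"
        using that by (intro add_mono mult_right_mono) auto
      finally show ?thesis using \<open>t * (norm u + norm v) < d\<close> by (simp add: distrib_left)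
    qed
    have swap: "p + s *\<^sub>R v + r *\<^sub>R u = p + r *\<^sub>R u + s *\<^sub>R v" for r s :: real
      by simp
    have sub: "p + r *\<^sub>R u + s *\<^sub>R v \<in> S" "p + s *\<^sub>R v + r *\<^sub>R u \<in> S"
      if "0 \<le> r" "r \<le> t" "0 \<le> s" "s \<le> t" for r s
      using d[OF near[OF that]] unfolding swap by simp_all
    have "\<exists>r s. 0 \<le> r \<and> r \<le> t \<and> 0 \<le> s \<and> s \<le> t \<and>
        f (p + t *\<^sub>R u + t *\<^sub>R v) - f (p + t *\<^sub>R u) - (f (p + t *\<^sub>R v) - f p)
          = t\<^sup>2 * A (p + r *\<^sub>R u + s *\<^sub>R v) v"
      by (rule mixed_difference_mvt[where S=S and f'=f' and A=A])
         (fact \<open>t > 0\<close>, erule (3) sub(1), erule f', erule A)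
    then obtain r s where rs: "0 \<le> r" "r \<le> t" "0 \<le> s" "s \<le> t"
      and 1: "f (p + t *\<^sub>R u + t *\<^sub>R v) - f (p + t *\<^sub>R u) - (f (p + t *\<^sub>R v) - f p)
              = t\<^sup>2 * A (p + r *\<^sub>R u + s *\<^sub>R v) v"
      by (elim exE conjE)
    have "\<exists>s r. 0 \<le> s \<and> s \<le> t \<and> 0 \<le> r \<and> r \<le> t \<and>
        f (p + t *\<^sub>R v + t *\<^sub>R u) - f (p + t *\<^sub>R v) - (f (p + t *\<^sub>R u) - f p)
          = t\<^sup>2 * B (p + s *\<^sub>R v + r *\<^sub>R u) u"
      by (rule mixed_difference_mvt[where S=S and f'=f' and A=B])
         (fact \<open>t > 0\<close>, rule sub(2), assumption+, erule f', erule B)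
    then obtain s' r' where rs': "0 \<le> s'" "s' \<le> t" "0 \<le> r'" "r' \<le> t"
      and 2: "f (p + t *\<^sub>R v + t *\<^sub>R u) - f (p + t *\<^sub>R v) - (f (p + t *\<^sub>R u) - f p)
              = t\<^sup>2 * B (p + s' *\<^sub>R v + r' *\<^sub>R u) u"
      by (elim exE conjE)
    have "A (p + r *\<^sub>R u + s *\<^sub>R v) v = B (p + s' *\<^sub>R v + r' *\<^sub>R u) u"
    proof -
      have "t\<^sup>2 * A (p + r *\<^sub>R u + s *\<^sub>R v) v = t\<^sup>2 * B (p + s' *\<^sub>R v + r' *\<^sub>R u) u"
        using 1 2 unfolding swap[where r=t and s=t] by linarith
      then show ?thesis using \<open>t > 0\<close> by simp
    qed
    then show ?thesis
      using d[OF near[OF rs]] d[OF near[OF rs'(3,4,1,2)]]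
      unfolding dist_real_def swap[where r=r' and s=s'] by linarith
  qed
  then have "\<bar>A p v - B p u\<bar> \<le> 0" using field_le_epsilon[of "\<bar>A p v - B p u\<bar>" 0] by simp
  then show ?thesis by simp
qed

text \<open>The mean value theorem needs real values, so the identity is tested against every vector
  \<open>c\<close>.\<close>

lemma second_derivative_symmetric:
  fixes f :: "'a::real_normed_vector \<Rightarrow> 'b::real_inner"
  assumes "open S" "p \<in> S"
    and f': "\<And>y. y \<in> S \<Longrightarrow> (f has_derivative f' y) (at y)"
    and A: "\<And>y. y \<in> S \<Longrightarrow> ((\<lambda>z. f' z u) has_derivative A y) (at y)"
    and B: "\<And>y. y \<in> S \<Longrightarrow> ((\<lambda>z. f' z v) has_derivative B y) (at y)"
    and cA: "continuous_on S (\<lambda>y. A y v)" and cB: "continuous_on S (\<lambda>y. B y u)"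
  shows "A p v = B p u"
proof -
  have "A p v \<bullet> c = B p u \<bullet> c" for c
    by (rule second_derivative_symmetric_real
          [where f="\<lambda>y. f y \<bullet> c" and f'="\<lambda>y h. f' y h \<bullet> c"
             and A="\<lambda>y h. A y h \<bullet> c" and B="\<lambda>y h. B y h \<bullet> c", OF \<open>open S\<close> \<open>p \<in> S\<close>])
       (simp_all add: has_derivative_inner_left f' A B continuous_on_inner cA cB)
  then show ?thesis using vector_eq_rdot[of "A p v" "B p u"] by simp
qed

text \<open>Continuity is asked for each direction \<open>v\<close> separately, the form in which
  \<open>Ck_on\<close> supplies it. The derivative is an explicit argument so that the rules that
  follow can compute it.\<close>

definition C1_on :: "'a::real_normed_vector set \<Rightarrow> ('a \<Rightarrow> 'b::real_normed_vector) \<Rightarrow> ('a \<Rightarrow> 'a \<Rightarrow> 'b) \<Rightarrow> bool"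
  where "C1_on S f f' \<longleftrightarrow>
    (\<forall>y\<in>S. (f has_derivative f' y) (at y)) \<and> (\<forall>v. continuous_on S (\<lambda>y. f' y v))"

lemma C1_on_continuous_on: "C1_on S f f' \<Longrightarrow> continuous_on S f"
  by (auto simp: C1_on_def intro!: continuous_at_imp_continuous_on dest: has_derivative_continuous)

text \<open>The continuity in the first claim comes from the second: the first directional
  derivatives are themselves differentiable.\<close>

lemma Ck_on_2_C1_on:
  fixes f :: "'a::euclidean_space \<Rightarrow> 'b::real_normed_vector"
  assumes "Ck_on 2 f S"
  shows "C1_on S f (\<lambda>y. frechet_derivative f (at y))"
    and "C1_on S (\<lambda>y. frechet_derivative f (at y) v)
          (\<lambda>y. frechet_derivative (\<lambda>y. frechet_derivative f (at y) v) (at y))"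
proof -
  have 1: "\<And>x. x \<in> S \<Longrightarrow> f differentiable (at x)"
    and 2: "\<And>x v. x \<in> S \<Longrightarrow> (\<lambda>y. frechet_derivative f (at y) v) differentiable (at x)"
    and 3: "\<And>v w. continuous_on S (\<lambda>x. frechet_derivative (\<lambda>y. frechet_derivative f (at y) v) (at x) w)"
    using assms by (simp_all add: numeral_2_eq_2)
  show "C1_on S (\<lambda>y. frechet_derivative f (at y) v)
          (\<lambda>y. frechet_derivative (\<lambda>y. frechet_derivative f (at y) v) (at y))" for v
    using 2 3 by (simp add: C1_on_def frechet_derivative_works)
  then show "C1_on S f (\<lambda>y. frechet_derivative f (at y))"
    using 1 by (auto simp: C1_on_def[of _ f] frechet_derivative_works intro: C1_on_continuous_on)
qed

lemma smooth_on_Ck: "smooth_on S f \<Longrightarrow> Ck_on k f S"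
  by (simp add: smooth_on_def)

lemma bounded_linear_column: "bounded_linear (\<lambda>A::real^'n^'m. column j A)"
  by (intro linear_conv_bounded_linear[THEN iffD1] linearI) (auto simp: column_def vec_eq_iff)

lemma bounded_bilinear_cross3: "bounded_bilinear cross3"
  using bilinear_cross by (simp add: bilinear_conv_bounded_bilinear)

lemma C1_on_column:
  fixes F :: "'a::real_normed_vector \<Rightarrow> real^'n^'m"
  assumes "C1_on S F F'"
  shows "C1_on S (\<lambda>y. column j (F y)) (\<lambda>y v. column j (F' y v))"
  using assms
  by (auto simp: C1_on_def intro!: bounded_linear.has_derivative[OF bounded_linear_column]
      bounded_linear.continuous_on[OF bounded_linear_column])

lemma C1_on_cross3:
  assumes "C1_on S f f'" "C1_on S g g'"
  shows "C1_on S (\<lambda>y. cross3 (f y) (g y)) (\<lambda>y v. cross3 (f y) (g' y v) + cross3 (f' y v) (g y))"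
  using assms C1_on_continuous_on[OF assms(1)] C1_on_continuous_on[OF assms(2)]
  by (auto simp: C1_on_def intro!: bounded_bilinear.FDERIV[OF bounded_bilinear_cross3]
      continuous_on_add continuous_on_cross)

text \<open>The derivative is the component of \<open>f' y v\<close> orthogonal to
  \<open>f y\<close>, divided by \<open>norm (f y)\<close>: normalising discards changes of
  length.\<close>

lemma C1_on_normalize:
  fixes f :: "'a::real_normed_vector \<Rightarrow> 'b::real_inner"
  assumes f: "C1_on S f f'" and nz: "\<And>y. y \<in> S \<Longrightarrow> f y \<noteq> 0"
  shows "C1_on S (\<lambda>y. f y /\<^sub>R norm (f y))
    (\<lambda>y v. f' y v /\<^sub>R norm (f y) - ((f y \<bullet> f' y v) / norm (f y) ^ 3) *\<^sub>R f y)"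
proof -
  have "((\<lambda>y. f y /\<^sub>R norm (f y)) has_derivative
     (\<lambda>v. f' y v /\<^sub>R norm (f y) - ((f y \<bullet> f' y v) / norm (f y) ^ 3) *\<^sub>R f y)) (at y)"
    if "y \<in> S" for y
  proof -
    have d: "(f has_derivative f' y) (at y)" using f that by (simp add: C1_on_def)
    have n: "((\<lambda>y. norm (f y)) has_derivative (\<lambda>v. f' y v \<bullet> sgn (f y))) (at y)"
      using has_derivative_compose[OF d has_derivative_norm] nz[OF that] by (simp add: inner_commute)
    have "norm (f y) \<noteq> 0" using nz[OF that] by simp
    show ?thesis
      by (rule has_derivative_eq_rhs
            [OF has_derivative_scaleR[OF Deriv.has_derivative_inverse[OF \<open>norm (f y) \<noteq> 0\<close> n] d]])
         (simp add: fun_eq_iff sgn_div_norm power3_eq_cube inner_commute divide_inverse)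
  qed
  moreover have "continuous_on S (\<lambda>y. f' y v)" for v using f by (simp add: C1_on_def)
  ultimately show ?thesis
    unfolding C1_on_def
    by (auto intro!: continuous_intros C1_on_continuous_on[OF f] simp: nz)
qed

section \<open>Matrices of size two and tangent frames\<close>

lemma adj2_nth [simp]:
  "adj2 A $ 1 $ 1 = A $ 2 $ 2" "adj2 A $ 1 $ 2 = - (A $ 1 $ 2)"
  "adj2 A $ 2 $ 1 = - (A $ 2 $ 1)" "adj2 A $ 2 $ 2 = A $ 1 $ 1"
  by (simp_all add: adj2_def)

lemmas mat2_simps = det_2 trace_def sum_2 matrix_matrix_mult_def transpose_def

text \<open>The adjugate reverses products, and \<open>J ** adj2 J\<close> is \<open>det J\<close>
  times the identity.\<close>

lemma trace_mult_adj2_mult_right: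
  "trace ((X ** J) ** adj2 (Y ** J)) = det J * trace (X ** adj2 Y)"
  by (simp add: mat2_simps) algebra

text \<open>In the product, the adjugates of \<open>J\<close> and \<open>C\<close> meet
  \<open>J\<close> and \<open>C\<close> and leave their determinants; transposing what remains gives
  the trace on the right. With \<open>J\<close> the Gram matrix of the frame this evaluates the
  numerator of the mean curvature.\<close>

lemma trace_adj2_congruence:
  "trace (adj2 (C ** J ** transpose C) ** (C ** J ** transpose D)) = det J * det C * trace (D ** adj2 C)"
  by (simp add: mat2_simps) algebra

lemma det_add_scaled_2:
  fixes C D :: "real^2^2"
  shows "det (C + l *\<^sub>R D) = det C + l * trace (D ** adj2 C) + l\<^sup>2 * det D"
  by (simp add: mat2_simps) algebra

text \<open>Lagrange's identity. It makes the Gram matrix of a frame invertible as soon as the cross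
  product of its columns is nonzero.\<close>

lemma det_gram:
  fixes M :: "real^2^3"
  shows "det (transpose M ** M) = (norm (cross3 (column 1 M) (column 2 M)))\<^sup>2"
  unfolding power2_norm_eq_inner
  by (simp add: mat2_simps cross3_simps column_def sum_3 inner_vec_def)

lemma matrix_inv_right_det:
  fixes A :: "real^'n^'n"
  assumes "det A \<noteq> 0"
  shows "A ** matrix_inv A = mat 1"
proof -
  have "\<exists>B. A ** B = mat 1 \<and> B ** A = mat 1"
    using assms unfolding invertible_det_nz[symmetric] invertible_def .
  from someI_ex[OF this] show ?thesis by (simp add: matrix_inv_def)
qed

lemma det_matrix_inv:
  fixes A :: "real^'n^'n"
  assumes "det A \<noteq> 0"
  shows "det (matrix_inv A) = inverse (det A)"
  using arg_cong[OF matrix_inv_right_det[OF assms], of det] assms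
  by (simp add: det_mul field_simps)

section \<open>Coordinates with respect to a tangent frame\<close>

definition coords_in :: "real^2^3 \<Rightarrow> real^2^3 \<Rightarrow> real^2^2" where
  "coords_in M A = transpose A ** M ** matrix_inv (transpose M ** M)"

text \<open>Cramer's rule for the Gram system. The proof checks a polynomial identity valid for
  every \<open>a\<close>: since the Gram determinant is the squared norm of \<open>w\<close>,
  subtracting \<open>(w \<bullet> a) *\<^sub>R w\<close> leaves that determinant times the
  projection of \<open>a\<close> to the plane of the frame.\<close>

lemma frame_expansion:
  fixes M :: "real^2^3" and a :: "real^3"
  defines "E \<equiv> column 1 M \<bullet> column 1 M" and "F \<equiv> column 1 M \<bullet> column 2 M"
    and "G \<equiv> column 2 M \<bullet> column 2 M"
  assumes "cross3 (column 1 M) (column 2 M) \<bullet> a = 0"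
  shows "det (transpose M ** M) *\<^sub>R a =
    (G * (a \<bullet> column 1 M) - F * (a \<bullet> column 2 M)) *\<^sub>R column 1 M +
    (E * (a \<bullet> column 2 M) - F * (a \<bullet> column 1 M)) *\<^sub>R column 2 M"
proof -
  define w where "w = cross3 (column 1 M) (column 2 M)"
  have "det (transpose M ** M) *\<^sub>R a - (w \<bullet> a) *\<^sub>R w =
    (G * (a \<bullet> column 1 M) - F * (a \<bullet> column 2 M)) *\<^sub>R column 1 M +
    (E * (a \<bullet> column 2 M) - F * (a \<bullet> column 1 M)) *\<^sub>R column 2 M"
    unfolding w_def E_def F_def G_def vec_eq_iff forall_3
    by (simp add: mat2_simps cross3_simps column_def sum_3 inner_vec_def; intro conjI; algebra)
  then show ?thesis using assms(4) by (simp add: w_def)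
qed

text \<open>Columns orthogonal to the normal direction lie in the span of the frame, so
  \<open>A = M ** C\<close> for some \<open>C\<close>; multiplying by \<open>transpose M\<close> and
  inverting the Gram matrix identifies \<open>C\<close>. Row \<open>j\<close> of
  \<open>coords_in M A\<close> thus holds the coordinates of column \<open>j\<close> of
  \<open>A\<close>.\<close>

lemma matrix_factor_through_frame:
  fixes A M :: "real^2^3"
  assumes nz: "cross3 (column 1 M) (column 2 M) \<noteq> 0"
    and perp: "\<And>j. cross3 (column 1 M) (column 2 M) \<bullet> column j A = 0"
  shows "A = M ** transpose (coords_in M A)"
proof -
  have d: "det (transpose M ** M) \<noteq> 0" using nz by (simp add: det_gram)
  have "\<exists>c1 c2. column j A = c1 *\<^sub>R column 1 M + c2 *\<^sub>R column 2 M" for j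
  proof -
    let ?g = "inverse (det (transpose M ** M))"
    have "column j A = ?g *\<^sub>R (det (transpose M ** M) *\<^sub>R column j A)"
      using d by simp
    then show ?thesis
      unfolding frame_expansion[OF perp] scaleR_add_right scaleR_scaleR by blast
  qed
  then obtain c1 c2 where c: "\<And>j. column j A = c1 j *\<^sub>R column 1 M + c2 j *\<^sub>R column 2 M"
    by metis
  define C :: "real^2^2" where "C = (\<chi> i j. if i = 1 then c1 j else c2 j)"
  have AC: "A = M ** C"
    using c by (simp add: vec_eq_iff column_def C_def matrix_matrix_mult_def sum_2 mult.commute)
  have "coords_in M A = transpose C ** ((transpose M ** M) ** matrix_inv (transpose M ** M))"
    unfolding AC coords_in_def by (simp add: matrix_transpose_mul matrix_mul_assoc)
  also have "\<dots> = transpose C" using matrix_inv_right_det[OF d] by simp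
  finally show ?thesis using AC by simp
qed

text \<open>Together with \<open>trace_coords_in\<close> this trades the matrix inverse for division
  by the Gram determinant, so that continuity can be read off from matrix entries.\<close>

lemma det_coords_in:
  assumes "cross3 (column 1 M) (column 2 M) \<noteq> 0"
  shows "det (coords_in M A) = det (transpose A ** M) / det (transpose M ** M)"
  using assms by (simp add: coords_in_def det_mul det_matrix_inv det_gram divide_inverse)

lemma trace_coords_in:
  assumes "cross3 (column 1 M) (column 2 M) \<noteq> 0"
  shows "trace (coords_in M A ** adj2 (coords_in M B)) =
    trace ((transpose A ** M) ** adj2 (transpose B ** M)) / det (transpose M ** M)"
  using assms
  by (simp only: coords_in_def trace_mult_adj2_mult_right)
     (simp add: det_matrix_inv det_gram divide_inverse mult.commute)

text \<open>For the converse direction, multiplying by \<open>transpose M\<close> gives the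
  invertible matrix \<open>transpose M ** M ** C\<close>.\<close>

lemma inj_frame_mult_iff:
  fixes M :: "real^2^3" and C :: "real^2^2"
  assumes "cross3 (column 1 M) (column 2 M) \<noteq> 0"
  shows "inj ((*v) (M ** C)) \<longleftrightarrow> det C \<noteq> 0"
proof
  assume "inj ((*v) (M ** C))"
  then have "inj ((*v) C)"
    by (auto simp: inj_def matrix_vector_mul_assoc[symmetric])
  then show "det C \<noteq> 0" using det_nz_iff_inj by (metis matrix_vector_mul_linear matrix_of_matrix_vector_mul)
next
  assume "det C \<noteq> 0"
  moreover have "invertible (transpose M ** M)"
    using assms by (simp add: invertible_det_nz det_gram)
  ultimately have "invertible (transpose M ** M ** C)"
    by (simp add: invertible_det_nz det_mul)
  then have "inj ((*v) (transpose M ** M ** C))" by (rule inj_matrix_vector_mult)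
  then show "inj ((*v) (M ** C))"
    by (auto simp: inj_def matrix_vector_mul_assoc[symmetric])
qed

section \<open>Sign changes and one-sided zeros\<close>

lemma filterlim_divide_at_top_iff:
  fixes g a :: "'a \<Rightarrow> real"
  assumes g: "(g \<longlongrightarrow> c) F" and "c > 0" and a: "(a \<longlongrightarrow> 0) F"
  shows "filterlim (\<lambda>q. g q / a q) at_top F \<longleftrightarrow> (\<forall>\<^sub>F q in F. a q > 0)"
proof
  assume "filterlim (\<lambda>q. g q / a q) at_top F"
  then have "\<forall>\<^sub>F q in F. g q / a q > 0" by (simp add: filterlim_at_top_dense)
  moreover have "\<forall>\<^sub>F q in F. g q > 0" using order_tendstoD(1)[OF g \<open>c > 0\<close>] .
  ultimately show "\<forall>\<^sub>F q in F. a q > 0"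
    by eventually_elim (simp add: zero_less_divide_iff)
next
  assume "\<forall>\<^sub>F q in F. a q > 0"
  then show "filterlim (\<lambda>q. g q / a q) at_top F" by (rule LIM_at_top_divide[OF g \<open>c > 0\<close> a])
qed

lemma filterlim_divide_at_bot_iff:
  fixes g a :: "'a \<Rightarrow> real"
  assumes g: "(g \<longlongrightarrow> c) F" and "c > 0" and a: "(a \<longlongrightarrow> 0) F"
  shows "filterlim (\<lambda>q. g q / a q) at_bot F \<longleftrightarrow> (\<forall>\<^sub>F q in F. a q < 0)"
  using filterlim_divide_at_top_iff[OF g \<open>c > 0\<close>, of "\<lambda>q. - a q"] tendsto_minus[OF a]
  by (simp add: filterlim_uminus_at_bot)

lemma no_sign_change_near_iff:
  assumes "open U" "p \<in> U"
  shows "no_sign_change_near U p f \<longleftrightarrow> (\<forall>\<^sub>F q in nhds p. f q \<ge> 0) \<or> (\<forall>\<^sub>F q in nhds p. f q \<le> 0)"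
proof -
  have "(\<forall>\<^sub>F q in nhds p. P q) \<longleftrightarrow> (\<exists>V. open V \<and> p \<in> V \<and> V \<subseteq> U \<and> (\<forall>q\<in>V. P q))" for P
  proof
    assume "\<forall>\<^sub>F q in nhds p. P q"
    then obtain S where "open S" "p \<in> S" "\<forall>q\<in>S. P q" unfolding eventually_nhds by blast
    then show "\<exists>V. open V \<and> p \<in> V \<and> V \<subseteq> U \<and> (\<forall>q\<in>V. P q)"
      using assms by (intro exI[of _ "S \<inter> U"]) auto
  qed (auto simp: eventually_nhds)
  then show ?thesis
    unfolding no_sign_change_near_def no_sign_change_on_def by auto
qed

lemma no_sign_change_near_uminus:
  "no_sign_change_near U p (\<lambda>q. - f q) \<longleftrightarrow> no_sign_change_near U p f"
  unfolding no_sign_change_near_def no_sign_change_on_def by auto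

text \<open>Near \<open>p\<close> the factor \<open>h\<close> has a constant strict sign, so it
  either preserves or exchanges the two alternatives.\<close>

lemma no_sign_change_near_mult:
  assumes "open U" "p \<in> U" and eq: "\<forall>\<^sub>F q in nhds p. f q = a q * h q"
    and h: "isCont h p" "h p \<noteq> 0"
  shows "no_sign_change_near U p f \<longleftrightarrow> no_sign_change_near U p a"
proof -
  have h': "(h \<longlongrightarrow> h p) (nhds p)" using h(1) by (simp add: isCont_def tendsto_nhds_iff)
  consider "\<forall>\<^sub>F q in nhds p. h q > 0" | "\<forall>\<^sub>F q in nhds p. h q < 0"
    using h(2) order_tendstoD[OF h'] by (meson linorder_neqE_linordered_idom)
  then show ?thesis
  proof cases
    case 1
    with eq have "\<forall>\<^sub>F q in nhds p. (0 \<le> f q \<longleftrightarrow> 0 \<le> a q) \<and> (f q \<le> 0 \<longleftrightarrow> a q \<le> 0)"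
      by eventually_elim (auto simp: zero_le_mult_iff mult_le_0_iff)
    then have "(\<forall>\<^sub>F q in nhds p. 0 \<le> f q) \<longleftrightarrow> (\<forall>\<^sub>F q in nhds p. 0 \<le> a q)"
      "(\<forall>\<^sub>F q in nhds p. f q \<le> 0) \<longleftrightarrow> (\<forall>\<^sub>F q in nhds p. a q \<le> 0)"
      by (auto intro!: eventually_subst elim: eventually_mono)
    then show ?thesis unfolding no_sign_change_near_iff[OF assms(1,2)] by simp
  next
    case 2
    with eq have "\<forall>\<^sub>F q in nhds p. (0 \<le> f q \<longleftrightarrow> a q \<le> 0) \<and> (f q \<le> 0 \<longleftrightarrow> 0 \<le> a q)"
      by eventually_elim (auto simp: zero_le_mult_iff mult_le_0_iff)
    then have "(\<forall>\<^sub>F q in nhds p. 0 \<le> f q) \<longleftrightarrow> (\<forall>\<^sub>F q in nhds p. a q \<le> 0)"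
      "(\<forall>\<^sub>F q in nhds p. f q \<le> 0) \<longleftrightarrow> (\<forall>\<^sub>F q in nhds p. 0 \<le> a q)"
      by (auto intro!: eventually_subst elim: eventually_mono)
    then show ?thesis unfolding no_sign_change_near_iff[OF assms(1,2)] by auto
  qed
qed

lemma diverges_at_quotient_pos:
  assumes "open U" "p \<in> U" "isCont a p" "a p = 0" "isCont g p" "g p > 0"
    and sing: "\<And>q. q \<in> U \<Longrightarrow> q \<in> singular_set U x \<longleftrightarrow> a q = 0"
    and eq: "\<forall>\<^sub>F q in nhds p. a q \<noteq> 0 \<longrightarrow> \<phi> q = g q / a q"
  shows "diverges_at U x p \<phi> \<longleftrightarrow> no_sign_change_near U p a"
proof -
  let ?F = "at p within (U - singular_set U x)"
  have U: "\<forall>\<^sub>F q in nhds p. q \<in> U" using assms(1,2) by (rule eventually_nhds_in_open)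
  have ga: "(g \<longlongrightarrow> g p) ?F" "(a \<longlongrightarrow> 0) ?F"
    using assms(3-5) by (auto simp: isCont_def intro: tendsto_within_subset)
  have "\<forall>\<^sub>F q in ?F. \<phi> q = g q / a q"
    unfolding eventually_at_filter using eq by eventually_elim (use sing in auto)
  then have "filterlim \<phi> G ?F \<longleftrightarrow> filterlim (\<lambda>q. g q / a q) G ?F" for G
    by (rule filterlim_cong[OF refl refl])
  then have "diverges_at U x p \<phi> \<longleftrightarrow> (\<forall>\<^sub>F q in ?F. a q > 0) \<or> (\<forall>\<^sub>F q in ?F. a q < 0)"
    unfolding diverges_at_def
    using filterlim_divide_at_top_iff[OF ga(1) \<open>g p > 0\<close> ga(2)]
      filterlim_divide_at_bot_iff[OF ga(1) \<open>g p > 0\<close> ga(2)] by simp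
  \<comment> \<open>On the singular set \<open>a\<close> vanishes, so the weak inequality holds
    there for free; off it \<open>a\<close> is nonzero, so weak and strict inequality coincide. This
    also covers a trivial filter, where \<open>a\<close> vanishes near \<open>p\<close>.\<close>
  also have "(\<forall>\<^sub>F q in ?F. a q > 0) \<longleftrightarrow> (\<forall>\<^sub>F q in nhds p. a q \<ge> 0)"
    unfolding eventually_at_filter
    by (rule eventually_subst, use U in eventually_elim) (use sing \<open>a p = 0\<close> in fastforce)
  also have "(\<forall>\<^sub>F q in ?F. a q < 0) \<longleftrightarrow> (\<forall>\<^sub>F q in nhds p. a q \<le> 0)"
    unfolding eventually_at_filter
    by (rule eventually_subst, use U in eventually_elim) (use sing \<open>a p = 0\<close> in fastforce)
  finally show ?thesis unfolding no_sign_change_near_iff[OF assms(1,2)] .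
qed

text \<open>Negating numerator and denominator leaves the quotient unchanged and reduces a negative
  \<open>g p\<close> to the positive case.\<close>

lemma diverges_at_quotient_iff:
  assumes "open U" "p \<in> U" "isCont a p" "a p = 0" "isCont g p" "g p \<noteq> 0"
    and sing: "\<And>q. q \<in> U \<Longrightarrow> q \<in> singular_set U x \<longleftrightarrow> a q = 0"
    and eq: "\<forall>\<^sub>F q in nhds p. a q \<noteq> 0 \<longrightarrow> \<phi> q = g q / a q"
  shows "diverges_at U x p \<phi> \<longleftrightarrow> no_sign_change_near U p a"
proof (cases "g p > 0")
  case True
  then show ?thesis using assms diverges_at_quotient_pos by blast
next
  case False
  have "diverges_at U x p \<phi> \<longleftrightarrow> no_sign_change_near U p (\<lambda>q. - a q)"
    by (rule diverges_at_quotient_pos[where g="\<lambda>q. - g q"]) (use assms False in auto)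
  then show ?thesis by (simp add: no_sign_change_near_uminus)
qed

section \<open>Small zeros of a quadratic polynomial with varying coefficients\<close>

lemma quadratic_nonzero_right_iff:
  fixes a b c :: "'a::t2_space \<Rightarrow> real"
  assumes "open U" "p \<in> U" and cont: "isCont a p" "isCont b p" "isCont c p"
    and "a p = 0" "b p > 0"
  shows "(\<exists>\<epsilon>>0. \<exists>V. open V \<and> p \<in> V \<and> V \<subseteq> U \<and>
            (\<forall>q\<in>V. \<forall>l\<in>{0<..<\<epsilon>}. a q + l * b q + l\<^sup>2 * c q \<noteq> 0)) \<longleftrightarrow>
         (\<forall>\<^sub>F q in nhds p. a q \<ge> 0)" (is "?L \<longleftrightarrow> ?R")
proof -
  \<comment> \<open>Near \<open>p\<close>, \<open>\<beta>\<close> bounds \<open>b\<close> from below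
    and \<open>C\<close> bounds the absolute value of \<open>c\<close> from above. For
    \<open>0 < l < \<beta> / C\<close> the factor \<open>b + l * c\<close> is then positive,
    uniformly in \<open>q\<close>.\<close>
  define \<beta> C where "\<beta> = b p / 2" and "C = \<bar>c p\<bar> + 1"
  have "\<beta> > 0" "C > 0" using \<open>b p > 0\<close> by (auto simp: \<beta>_def C_def)
  have lim: "(a \<longlongrightarrow> a p) (nhds p)" "(b \<longlongrightarrow> b p) (nhds p)" "(c \<longlongrightarrow> c p) (nhds p)"
    using cont by (simp_all add: isCont_def tendsto_nhds_iff)
  have nb: "\<forall>\<^sub>F q in nhds p. b q > \<beta>"
    by (rule order_tendstoD(1)[OF lim(2)]) (use \<open>b p > 0\<close> in \<open>simp add: \<beta>_def\<close>)
  have nc: "\<forall>\<^sub>F q in nhds p. \<bar>c q\<bar> < C"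
    by (rule order_tendstoD(2)[OF tendsto_rabs[OF lim(3)]]) (simp add: C_def)
  have slope: "b' + l * c' > 0" if "b' > \<beta>" "\<bar>c'\<bar> < C" "0 < l" "l < \<beta> / C" for b' c' l
  proof -
    have "\<bar>l * c'\<bar> \<le> l * C" using that by (simp add: abs_mult)
    also have "\<dots> < \<beta>" using that \<open>C > 0\<close> by (simp add: field_simps)
    finally show ?thesis using that by linarith
  qed
  have quad: "a' + l * b' + l\<^sup>2 * c' = a' + l * (b' + l * c')" for a' b' c' l :: real
    by (simp add: power2_eq_square algebra_simps)
  show ?thesis
  proof
    assume ?R
    have "\<forall>\<^sub>F q in nhds p. q \<in> U \<and> a q \<ge> 0 \<and> b q > \<beta> \<and> \<bar>c q\<bar> < C"
      using \<open>?R\<close> nb nc eventually_nhds_in_open[OF assms(1,2)]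
      by eventually_elim simp
    then obtain V where V: "open V" "p \<in> V" "\<forall>q\<in>V. q \<in> U \<and> a q \<ge> 0 \<and> b q > \<beta> \<and> \<bar>c q\<bar> < C"
      unfolding eventually_nhds by blast
    have "a q + l * b q + l\<^sup>2 * c q \<noteq> 0" if "q \<in> V" "l \<in> {0<..<\<beta> / C}" for q l
    proof -
      have "l * (b q + l * c q) > 0" using slope V(3) that by simp
      then show ?thesis using V(3) that unfolding quad by (smt (verit))
    qed
    then show ?L
      using V \<open>\<beta> > 0\<close> \<open>C > 0\<close> by (intro exI[of _ "\<beta> / C"] conjI exI[of _ V]) auto
  next
    assume ?L
    then obtain \<epsilon> V where "\<epsilon> > 0" and V: "open V" "p \<in> V"
      and nz: "\<And>q l. q \<in> V \<Longrightarrow> 0 < l \<Longrightarrow> l < \<epsilon> \<Longrightarrow> a q + l * b q + l\<^sup>2 * c q \<noteq> 0"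
      by auto
    \<comment> \<open>Halving the minimum puts \<open>l\<close> strictly below both bounds:
      \<open>\<epsilon>\<close>, where no zeros occur, and \<open>\<beta> / C\<close>, where the
      slope is positive. For this fixed \<open>l\<close> the polynomial is positive at
      \<open>p\<close>, hence near \<open>p\<close>.\<close>
    define l where "l = min \<epsilon> (\<beta> / C) / 2"
    have half_less: "m / 2 < m" if "0 < m" for m :: real using that by simp
    have "0 < min \<epsilon> (\<beta> / C)" using \<open>\<epsilon> > 0\<close> \<open>\<beta> > 0\<close> \<open>C > 0\<close> by simp
    then have "0 < l" "l < min \<epsilon> (\<beta> / C)"
      using half_less[of "min \<epsilon> (\<beta> / C)"] unfolding l_def by (blast intro: half_gt_zero)+
    then have l: "0 < l" "l < \<epsilon>" "l < \<beta> / C" by simp_all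
    have "l * (b p + l * c p) > 0"
      by (intro mult_pos_pos slope l) (use \<open>b p > 0\<close> in \<open>auto simp: \<beta>_def C_def\<close>)
    then have "a p + l * b p + l\<^sup>2 * c p > 0"
      unfolding quad using \<open>a p = 0\<close> by simp
    moreover have "((\<lambda>q. a q + l * b q + l\<^sup>2 * c q) \<longlongrightarrow> a p + l * b p + l\<^sup>2 * c p) (nhds p)"
      by (intro tendsto_intros lim)
    ultimately have "\<forall>\<^sub>F q in nhds p. a q + l * b q + l\<^sup>2 * c q > 0"
      by (rule order_tendstoD(1)[rotated])
    moreover have "\<forall>\<^sub>F q in nhds p. q \<in> V" using V by (rule eventually_nhds_in_open)
    ultimately show ?R
    proof eventually_elim
      case (elim q)
      show "a q \<ge> 0"
      proof (rule ccontr)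
        assume "\<not> a q \<ge> 0"
        \<comment> \<open>The polynomial in \<open>m\<close> is negative at 0, where it equals
          \<open>a q\<close>, and positive at \<open>l\<close>.\<close>
        then obtain m where m: "0 \<le> m" "m \<le> l" "a q + m * b q + m\<^sup>2 * c q = 0"
          using IVT'[of "\<lambda>m. a q + m * b q + m\<^sup>2 * c q" 0 0 l] elim l
          by (force intro!: continuous_intros)
        then have "m \<noteq> 0" using \<open>\<not> a q \<ge> 0\<close> by auto
        then show False using nz[OF elim(2), of m] m l by auto
      qed
    qed
  qed
qed

lemma quadratic_nonzero_one_sided_iff_pos:
  fixes a b c :: "real^2 \<Rightarrow> real"
  assumes "open U" "p \<in> U" and cont: "isCont a p" "isCont b p" "isCont c p"
    and "a p = 0" "b p > 0"
  shows "(\<exists>\<epsilon>>0. \<exists>V. open V \<and> p \<in> V \<and> V \<subseteq> U \<and>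
            ((\<forall>q\<in>V. \<forall>l\<in>{0<..<\<epsilon>}. a q + l * b q + l\<^sup>2 * c q \<noteq> 0) \<or>
             (\<forall>q\<in>V. \<forall>l\<in>{-\<epsilon><..<0}. a q + l * b q + l\<^sup>2 * c q \<noteq> 0))) \<longleftrightarrow>
         no_sign_change_near U p a" (is "?L \<longleftrightarrow> _")
proof -
  \<comment> \<open>Negating both \<open>l\<close> and the polynomial maps the left interval to the
    right one, changes the signs of \<open>a\<close> and \<open>c\<close> and keeps
    \<open>b\<close>, so the right-sided criterion applies again.\<close>
  have flip: "(\<forall>l\<in>{-\<epsilon><..<0}. a q + l * b q + l\<^sup>2 * c q \<noteq> 0) \<longleftrightarrow>
      (\<forall>l\<in>{0<..<\<epsilon>}. - a q + l * b q + l\<^sup>2 * - c q \<noteq> 0)" for \<epsilon> q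
  proof -
    have "{-\<epsilon><..<0} = uminus ` {0<..<\<epsilon>}" by simp
    moreover have "(a q + - l * b q + (- l)\<^sup>2 * c q = 0) \<longleftrightarrow> (- a q + l * b q + l\<^sup>2 * - c q = 0)" for l
      by auto
    ultimately show ?thesis by (simp only: ball_simps)
  qed
  have "?L \<longleftrightarrow>
      (\<exists>\<epsilon>>0. \<exists>V. open V \<and> p \<in> V \<and> V \<subseteq> U \<and>
            (\<forall>q\<in>V. \<forall>l\<in>{0<..<\<epsilon>}. a q + l * b q + l\<^sup>2 * c q \<noteq> 0)) \<or>
      (\<exists>\<epsilon>>0. \<exists>V. open V \<and> p \<in> V \<and> V \<subseteq> U \<and>
            (\<forall>q\<in>V. \<forall>l\<in>{0<..<\<epsilon>}. - a q + l * b q + l\<^sup>2 * - c q \<noteq> 0))"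
    unfolding flip by blast
  also have "\<dots> \<longleftrightarrow> (\<forall>\<^sub>F q in nhds p. a q \<ge> 0) \<or> (\<forall>\<^sub>F q in nhds p. - a q \<ge> 0)"
    using assms quadratic_nonzero_right_iff[OF assms(1,2), of a b c]
      quadratic_nonzero_right_iff[OF assms(1,2), of "\<lambda>q. - a q" b "\<lambda>q. - c q"] by simp
  finally show ?thesis unfolding no_sign_change_near_iff[OF assms(1,2)] by simp
qed

lemma quadratic_nonzero_one_sided_iff:
  fixes a b c :: "real^2 \<Rightarrow> real"
  assumes "open U" "p \<in> U" and cont: "isCont a p" "isCont b p" "isCont c p"
    and "a p = 0" "b p \<noteq> 0"
  shows "(\<exists>\<epsilon>>0. \<exists>V. open V \<and> p \<in> V \<and> V \<subseteq> U \<and>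
            ((\<forall>q\<in>V. \<forall>l\<in>{0<..<\<epsilon>}. a q + l * b q + l\<^sup>2 * c q \<noteq> 0) \<or>
             (\<forall>q\<in>V. \<forall>l\<in>{-\<epsilon><..<0}. a q + l * b q + l\<^sup>2 * c q \<noteq> 0))) \<longleftrightarrow>
         no_sign_change_near U p a"
proof (cases "b p > 0")
  case True
  then show ?thesis using assms by (intro quadratic_nonzero_one_sided_iff_pos)
next
  case False
  have neg: "(- a q + l * - b q + l\<^sup>2 * - c q = 0) \<longleftrightarrow> (a q + l * b q + l\<^sup>2 * c q = 0)" for q l
    by auto
  show ?thesis
    using quadratic_nonzero_one_sided_iff_pos[OF assms(1,2), of "\<lambda>q. - a q" "\<lambda>q. - b q" "\<lambda>q. - c q"]
      assms False
    unfolding neg no_sign_change_near_uminus by simp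
qed

section \<open>Surfaces with a tangent moving basis\<close>

lemma column_Dmat: "column j (Dmat f q) = frechet_derivative f (at q) (axis j 1)"
  by (simp add: column_def jacobian_def matrix_def vec_eq_iff)

lemma column_Dmat_has_derivative:
  assumes "(f has_derivative f') (at q)"
  shows "column j (Dmat f q) = f' (axis j 1)"
  by (simp add: column_Dmat frechet_derivative_at[OF assms, symmetric])

lemma frechet_derivative_Dmat:
  assumes "f differentiable (at q)"
  shows "frechet_derivative f (at q) = (*v) (Dmat f q)"
  using frechet_derivative_at[OF iffD1[OF jacobian_works assms]] by (simp add: fun_eq_iff)

lemma Dmat_add_scaled:
  assumes "f differentiable (at q)" "g differentiable (at q)"
  shows "Dmat (\<lambda>r. f r + l *\<^sub>R g r) q = Dmat f q + l *\<^sub>R Dmat g q"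
proof -
  have "((\<lambda>r. f r + l *\<^sub>R g r) has_derivative (\<lambda>h. Dmat f q *v h + l *\<^sub>R (Dmat g q *v h))) (at q)"
    using assms unfolding jacobian_works by (intro derivative_intros)
  then have "frechet_derivative (\<lambda>r. f r + l *\<^sub>R g r) (at q) = (\<lambda>h. Dmat f q *v h + l *\<^sub>R (Dmat g q *v h))"
    by (rule frechet_derivative_at[symmetric])
  also have "\<dots> = (*v) (Dmat f q + l *\<^sub>R Dmat g q)"
    by (simp add: fun_eq_iff matrix_vector_mult_add_rdistrib scaleR_matrix_vector_assoc)
  finally show ?thesis
    unfolding jacobian_def[of "\<lambda>r. f r + l *\<^sub>R g r"] by (simp only: matrix_of_matrix_vector_mul)
qed

text \<open>The product rule for a constant inner product. It serves twice: for the unit length of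
  the normal and for its orthogonality to the partial derivatives of the surface.\<close>

lemma has_derivative_inner_eq_const:
  fixes f g :: "'a::real_normed_vector \<Rightarrow> 'b::real_inner"
  assumes "open S" "q \<in> S" and "(f has_derivative f') (at q)" "(g has_derivative g') (at q)"
    and const: "\<And>y. y \<in> S \<Longrightarrow> f y \<bullet> g y = k"
  shows "f q \<bullet> g' h + f' h \<bullet> g q = 0"
proof -
  have "((\<lambda>y. f y \<bullet> g y) has_derivative (\<lambda>h. f q \<bullet> g' h + f' h \<bullet> g q)) (at q)"
    by (intro has_derivative_inner assms)
  moreover have "((\<lambda>y. f y \<bullet> g y) has_derivative (\<lambda>h. 0)) (at q)"
    by (rule has_derivative_transform_within_open[OF has_derivative_const[of k] \<open>open S\<close> \<open>q \<in> S\<close>])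
       (simp add: const)
  ultimately have "(\<lambda>h. f q \<bullet> g' h + f' h \<bullet> g q) = (\<lambda>h. 0)" by (rule has_derivative_unique)
  then show ?thesis by (rule fun_cong)
qed

text \<open>For \<open>u = v\<close> the set would collapse to a singleton, which is independent
  when \<open>u\<close> is nonzero.\<close>

lemma cross3_eq_0_imp_dependent:
  assumes "cross3 u v = 0" "u \<noteq> v"
  shows "dependent {u, v}"
proof -
  have "collinear {0, u, v}" using assms by (simp add: cross_eq_0)
  then consider "u = 0" | "v = 0" | c where "v = c *\<^sub>R u" by (auto simp: collinear_lemma)
  then show ?thesis
  proof cases
    case 3
    then have "v \<in> span ({u, v} - {v})" using \<open>u \<noteq> v\<close> by (auto simp: span_base intro: span_scale)
    then show ?thesis unfolding dependent_def by blast
  qed (simp_all add: dependent_zero)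
qed

lemma cross3_perp_span:
  assumes "a \<in> span {u, v}"
  shows "cross3 u v \<bullet> a = 0"
proof -
  have "orthogonal (cross3 u v) a"
    by (rule orthogonal_to_span[OF assms]) (auto simp: orthogonal_def dot_cross_self inner_commute)
  then show ?thesis by (simp add: orthogonal_def)
qed

section \<open>The normal field and the relative invariants of a framed surface\<close>

locale framed_surface =
  fixes U :: "(real^2) set" and x :: "real^2 \<Rightarrow> real^3" and \<Omega> :: "real^2 \<Rightarrow> real^2^3"
  assumes open_U: "open U" and smooth_x: "smooth_on U x"
    and tmb: "tangent_moving_basis U x \<Omega>"
begin

abbreviation "w q \<equiv> cross3 (column 1 (\<Omega> q)) (column 2 (\<Omega> q))"
abbreviation "\<nu> \<equiv> tmb_normal \<Omega>"

lemma w_nonzero: "q \<in> U \<Longrightarrow> w q \<noteq> 0"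
  using tmb by (auto simp: tangent_moving_basis_def dest: cross3_eq_0_imp_dependent)

lemma normal_eq: "\<nu> q = w q /\<^sub>R norm (w q)"
  by (simp add: tmb_normal_def Let_def)

lemma normal_unit: "q \<in> U \<Longrightarrow> \<nu> q \<bullet> \<nu> q = 1"
  using w_nonzero[of q] by (simp add: normal_eq dot_square_norm power2_eq_square)

lemma w_perp_iff: "q \<in> U \<Longrightarrow> w q \<bullet> a = 0 \<longleftrightarrow> \<nu> q \<bullet> a = 0"
  using w_nonzero[of q] by (simp add: normal_eq)

lemma w_perp_tangent: "q \<in> U \<Longrightarrow> w q \<bullet> column j (Dmat x q) = 0"
  using tmb exhaust_2[of j]
  by (auto simp: tangent_moving_basis_def intro!: cross3_perp_span)

lemma C1_x: "C1_on U x (\<lambda>q. frechet_derivative x (at q))"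
  and C1_dx: "C1_on U (\<lambda>q. frechet_derivative x (at q) v)
      (\<lambda>q. frechet_derivative (\<lambda>q. frechet_derivative x (at q) v) (at q))"
  using Ck_on_2_C1_on[OF smooth_on_Ck[OF smooth_x]] by blast+

lemma C1_normal: obtains N where "C1_on U \<nu> N"
proof -
  have "C1_on U \<Omega> (\<lambda>q. frechet_derivative \<Omega> (at q))"
    using tmb by (intro Ck_on_2_C1_on smooth_on_Ck) (simp add: tangent_moving_basis_def)
  from C1_on_normalize[OF C1_on_cross3[OF C1_on_column[OF this] C1_on_column[OF this]] w_nonzero]
  show thesis by (intro that) (simp add: normal_eq[abs_def])
qed

lemma differentiable: "q \<in> U \<Longrightarrow> x differentiable (at q)" "q \<in> U \<Longrightarrow> \<nu> differentiable (at q)"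
proof -
  obtain N where "C1_on U \<nu> N" by (rule C1_normal)
  then show "q \<in> U \<Longrightarrow> x differentiable (at q)" "q \<in> U \<Longrightarrow> \<nu> differentiable (at q)"
    using C1_x by (auto simp: C1_on_def differentiable_def)
qed

lemma normal_perp_Dnormal: "q \<in> U \<Longrightarrow> \<nu> q \<bullet> column j (Dmat \<nu> q) = 0"
proof -
  assume q: "q \<in> U"
  obtain N where "C1_on U \<nu> N" by (rule C1_normal)
  then have d: "(\<nu> has_derivative N q) (at q)" using q by (simp add: C1_on_def)
  show ?thesis
    using has_derivative_inner_eq_const[OF open_U q d d normal_unit, of "axis j 1"]
    by (simp add: column_Dmat_has_derivative[OF d] inner_commute)
qed

lemma Dx_eq: "q \<in> U \<Longrightarrow> Dmat x q = \<Omega> q ** transpose (coords_in (\<Omega> q) (Dmat x q))"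
  by (intro matrix_factor_through_frame w_nonzero w_perp_tangent)

lemma Dnormal_eq: "q \<in> U \<Longrightarrow> Dmat \<nu> q = \<Omega> q ** transpose (coords_in (\<Omega> q) (Dmat \<nu> q))"
  by (intro matrix_factor_through_frame w_nonzero) (simp_all add: w_perp_iff normal_perp_Dnormal)

lemma Lambda_rel_eq: "Lambda_rel x \<Omega> q = coords_in (\<Omega> q) (Dmat x q)"
  by (simp add: Lambda_rel_def coords_in_def I_rel_def)

text \<open>The minus signs in \<open>II_rel\<close> and \<open>mu_rel\<close> cancel.\<close>

lemma mu_rel_eq: "mu_rel \<Omega> q = coords_in (\<Omega> q) (Dmat \<nu> q)"
proof -
  have "- (transpose (- A) ** B) = transpose A ** B" for A B :: "real^2^2"
    by (simp add: vec_eq_iff transpose_def matrix_matrix_mult_def sum_2)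
  then show ?thesis
    by (simp add: mu_rel_def II_rel_def coords_in_def I_rel_def matrix_transpose_mul)
qed

text \<open>Differentiating the orthogonality of \<open>\<nu>\<close> to each partial derivative of
  \<open>x\<close> expresses the entries through mixed second derivatives of \<open>x\<close>, which
  commute. The classical curvatures read only the upper right entry, so symmetry is what relates
  them to determinants and traces.\<close>

lemma second_form_symmetric:
  assumes q: "q \<in> U"
  shows "(transpose (Dmat x q) ** Dmat \<nu> q) $ 1 $ 2 = (transpose (Dmat x q) ** Dmat \<nu> q) $ 2 $ 1"
proof -
  obtain N where N: "C1_on U \<nu> N" by (rule C1_normal)
  then have d: "(\<nu> has_derivative N q) (at q)" using q by (simp add: C1_on_def)
  let ?A = "\<lambda>v q. frechet_derivative (\<lambda>q. frechet_derivative x (at q) v) (at q)"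
  have dx: "((\<lambda>q. frechet_derivative x (at q) v) has_derivative ?A v y) (at y)" if "y \<in> U" for v y
    using C1_dx[of v] that by (simp add: C1_on_def)
  let ?u = "axis 1 1 :: real^2" and ?v = "axis 2 1 :: real^2"
  have sym: "?A ?u q ?v = ?A ?v q ?u"
    by (rule second_derivative_symmetric
          [where f=x and f'="\<lambda>q. frechet_derivative x (at q)" and A="?A ?u" and B="?A ?v",
            OF open_U q])
       (use C1_x C1_dx in \<open>auto simp: C1_on_def\<close>)
  have weingarten: "\<nu> q \<bullet> ?A (axis i 1) q h = - (N q h \<bullet> column i (Dmat x q))" for i h
    using has_derivative_inner_eq_const[OF open_U q d dx[OF q], of "axis i 1" 0 h]
      w_perp_tangent w_perp_iff by (simp add: column_Dmat)
  have entry: "(transpose (Dmat x q) ** Dmat \<nu> q) $ i $ j = N q (axis j 1) \<bullet> column i (Dmat x q)" for i j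
    unfolding column_Dmat_has_derivative[OF d, symmetric]
    by (simp add: matrix_matrix_mult_def transpose_def column_def inner_vec_def mult.commute)
  show ?thesis
    using weingarten[of 1 ?v] weingarten[of 2 ?u] sym unfolding entry by simp
qed

text \<open>The differential of \<open>x\<close> is the injective matrix \<open>\<Omega> q\<close>
  times the transpose of \<open>Lambda_rel x \<Omega> q\<close>.\<close>

lemma singular_iff: "q \<in> U \<Longrightarrow> q \<in> singular_set U x \<longleftrightarrow> lambda_rel x \<Omega> q = 0"
proof -
  assume q: "q \<in> U"
  have "immersive_at x q \<longleftrightarrow> inj ((*v) (\<Omega> q ** transpose (coords_in (\<Omega> q) (Dmat x q))))"
    using differentiable(1)[OF q]
    by (simp add: immersive_at_def frechet_derivative_Dmat flip: Dx_eq[OF q])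
  also have "\<dots> \<longleftrightarrow> lambda_rel x \<Omega> q \<noteq> 0"
    using inj_frame_mult_iff[OF w_nonzero[OF q]] by (simp add: lambda_rel_def Lambda_rel_eq)
  finally show ?thesis using q by (simp add: singular_set_def)
qed

text \<open>The differential of the parallel surface is \<open>\<Omega> q\<close> times the
  transpose of \<open>Lambda_rel x \<Omega> q + l *\<^sub>R mu_rel \<Omega> q\<close>; the quadratic
  polynomial is the determinant of that sum.\<close>

lemma rank_parallel_iff:
  assumes q: "q \<in> U"
  shows "rank (Dmat (\<lambda>r. x r + l *\<^sub>R \<nu> r) q) = 2 \<longleftrightarrow>
    lambda_rel x \<Omega> q + l * (- 2 * H_rel x \<Omega> q) + l\<^sup>2 * K_rel \<Omega> q \<noteq> 0"
proof -
  let ?C = "coords_in (\<Omega> q) (Dmat x q)" and ?D = "coords_in (\<Omega> q) (Dmat \<nu> q)"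
  have "Dmat (\<lambda>r. x r + l *\<^sub>R \<nu> r) q = \<Omega> q ** transpose ?C + l *\<^sub>R (\<Omega> q ** transpose ?D)"
    using differentiable[OF q] by (simp add: Dmat_add_scaled flip: Dx_eq[OF q] Dnormal_eq[OF q])
  also have "\<dots> = \<Omega> q ** transpose (?C + l *\<^sub>R ?D)"
    by (simp add: vec_eq_iff matrix_matrix_mult_def transpose_def sum_2 algebra_simps)
  finally have "rank (Dmat (\<lambda>r. x r + l *\<^sub>R \<nu> r) q) = 2 \<longleftrightarrow> det (?C + l *\<^sub>R ?D) \<noteq> 0"
    using full_rank_injective[of "Dmat (\<lambda>r. x r + l *\<^sub>R \<nu> r) q"] inj_frame_mult_iff[OF w_nonzero[OF q]]
    by simp
  then show ?thesis
    by (simp add: det_add_scaled_2 lambda_rel_def H_rel_def K_rel_def Lambda_rel_eq mu_rel_eq)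
qed

text \<open>With \<open>J\<close> the Gram matrix of the frame, the fundamental forms are
  \<open>C ** J ** transpose C\<close> and \<open>- (C ** J ** transpose D)\<close>. In both
  quotients \<open>det J\<close> and one factor \<open>det C\<close> cancel.\<close>

lemma curvatures:
  assumes q: "q \<in> U" and nz: "lambda_rel x \<Omega> q \<noteq> 0"
  shows "gauss_curv x \<Omega> q = K_rel \<Omega> q / lambda_rel x \<Omega> q"
    and "mean_curv x \<Omega> q = H_rel x \<Omega> q / lambda_rel x \<Omega> q"
proof -
  define C D J where "C = coords_in (\<Omega> q) (Dmat x q)" and "D = coords_in (\<Omega> q) (Dmat \<nu> q)"
    and "J = transpose (\<Omega> q) ** \<Omega> q"
  have "det J \<noteq> 0" using w_nonzero[OF q] by (simp add: J_def det_gram)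
  have Dx: "Dmat x q = \<Omega> q ** transpose C" and Dn: "Dmat \<nu> q = \<Omega> q ** transpose D"
    unfolding C_def D_def by (rule Dx_eq[OF q], rule Dnormal_eq[OF q])
  have I: "fundI x q = C ** J ** transpose C"
    by (simp add: fundI_def Dx J_def matrix_transpose_mul matrix_mul_assoc)
  have II: "fundII x \<Omega> q = - (C ** J ** transpose D)"
    by (simp add: fundII_def Dx Dn J_def matrix_transpose_mul matrix_mul_assoc)
  have symI: "fundI x q $ 2 $ 1 = fundI x q $ 1 $ 2"
    by (simp add: fundI_def matrix_matrix_mult_def transpose_def mult.commute)
  have symII: "fundII x \<Omega> q $ 2 $ 1 = fundII x \<Omega> q $ 1 $ 2"
    using second_form_symmetric[OF q] by (simp add: fundII_def)
  have C: "det C = lambda_rel x \<Omega> q" by (simp add: C_def lambda_rel_def Lambda_rel_eq)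
  have D: "det D = K_rel \<Omega> q" by (simp add: D_def K_rel_def mu_rel_eq)
  have neg: "det (- A) = det A" "trace (B ** - A) = - trace (B ** A)" for A B :: "real^2^2"
    by (simp_all add: mat2_simps)
  have "gauss_curv x \<Omega> q = det (fundII x \<Omega> q) / det (fundI x q)"
    by (simp add: gauss_curv_def Let_def det_2 symI symII power2_eq_square)
  also have "\<dots> = det D / det C"
    using \<open>det J \<noteq> 0\<close> nz by (simp add: I II neg det_mul C[symmetric])
  finally show "gauss_curv x \<Omega> q = K_rel \<Omega> q / lambda_rel x \<Omega> q" by (simp only: C D)
  \<comment> \<open>For symmetric forms, \<open>e * G + g * E - 2 * f * F\<close> is the trace of
    the adjugate of the first form times the second.\<close>
  have "mean_curv x \<Omega> q = trace (adj2 (fundI x q) ** fundII x \<Omega> q) / (2 * det (fundI x q))"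
    by (simp add: mean_curv_def Let_def mat2_simps symI symII power2_eq_square algebra_simps)
  also have "\<dots> = - (1/2) * trace (D ** adj2 C) / det C"
    using \<open>det J \<noteq> 0\<close> nz
    unfolding I II neg trace_adj2_congruence by (simp add: det_mul C[symmetric])
  finally show "mean_curv x \<Omega> q = H_rel x \<Omega> q / lambda_rel x \<Omega> q"
    unfolding C by (simp add: H_rel_def C_def D_def Lambda_rel_eq mu_rel_eq)
qed

lemma continuous_invariants:
  "continuous_on U (lambda_rel x \<Omega>)" "continuous_on U (K_rel \<Omega>)" "continuous_on U (H_rel x \<Omega>)"
proof -
  obtain N where N: "C1_on U \<nu> N" by (rule C1_normal)
  \<comment> \<open>Columns of a Jacobian are directional derivatives, whose continuity
    \<open>C1_on\<close> provides; entries inherit it.\<close>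
  have entry: "continuous_on U (\<lambda>q. A q $ i $ j)"
    if "\<And>j. continuous_on U (\<lambda>q. column j (A q))" for A :: "real^2 \<Rightarrow> real^2^3" and i j
    using continuous_on_component[OF that, of j i] by (simp add: column_def)
  have "continuous_on U \<Omega>"
    using smooth_on_Ck[of U \<Omega> 0] tmb by (simp add: tangent_moving_basis_def)
  then have c\<Omega>: "continuous_on U (\<lambda>q. \<Omega> q $ i $ j)" for i j
    by (intro continuous_intros)
  have cx: "continuous_on U (\<lambda>q. Dmat x q $ i $ j)" for i j
    by (rule entry) (use C1_x in \<open>auto simp: C1_on_def column_Dmat\<close>)
  have cn: "continuous_on U (\<lambda>q. Dmat \<nu> q $ i $ j)" for i j
  proof (rule entry)
    fix j
    have "continuous_on U (\<lambda>q. N q (axis j 1))" using N by (simp add: C1_on_def)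
    then show "continuous_on U (\<lambda>q. column j (Dmat \<nu> q))"
      by (rule continuous_on_eq) (use N in \<open>auto simp: C1_on_def column_Dmat_has_derivative\<close>)
  qed
  have nz: "\<And>q. q \<in> U \<Longrightarrow> det (transpose (\<Omega> q) ** \<Omega> q) \<noteq> 0"
    using w_nonzero by (simp add: det_gram)
  note arith_intros = continuous_on_add continuous_on_diff continuous_on_mult continuous_on_minus
  note simps = det_2 trace_def sum_2 sum_3 matrix_matrix_mult_def transpose_def
  have cd: "continuous_on U (\<lambda>q. det (transpose (\<Omega> q) ** \<Omega> q))"
    by (simp add: simps) (intro arith_intros c\<Omega>)
  have "continuous_on U (\<lambda>q. det (transpose (Dmat x q) ** \<Omega> q) / det (transpose (\<Omega> q) ** \<Omega> q))"
    by (intro continuous_on_divide cd, simp add: simps, intro arith_intros c\<Omega> cx) (use nz in auto)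
  then show "continuous_on U (lambda_rel x \<Omega>)"
    by (rule continuous_on_eq) (simp add: lambda_rel_def Lambda_rel_eq det_coords_in w_nonzero)
  have "continuous_on U (\<lambda>q. det (transpose (Dmat \<nu> q) ** \<Omega> q) / det (transpose (\<Omega> q) ** \<Omega> q))"
    by (intro continuous_on_divide cd, simp add: simps, intro arith_intros c\<Omega> cn) (use nz in auto)
  then show "continuous_on U (K_rel \<Omega>)"
    by (rule continuous_on_eq) (simp add: K_rel_def mu_rel_eq det_coords_in w_nonzero)
  have "continuous_on U (\<lambda>q. - (1/2) *
      (trace ((transpose (Dmat \<nu> q) ** \<Omega> q) ** adj2 (transpose (Dmat x q) ** \<Omega> q)) /
        det (transpose (\<Omega> q) ** \<Omega> q)))"
    by (intro continuous_on_mult continuous_on_const continuous_on_divide cd, simp add: simps,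
        intro arith_intros c\<Omega> cx cn) (use nz in auto)
  then show "continuous_on U (H_rel x \<Omega>)"
    by (rule continuous_on_eq)
       (simp add: H_rel_def Lambda_rel_eq mu_rel_eq trace_coords_in w_nonzero)
qed

end

lemma sqrt_discriminant_divide:
  fixes h k d :: real
  assumes "d \<noteq> 0"
  shows "sqrt ((h / d)\<^sup>2 - k / d) = sqrt (h\<^sup>2 - d * k) / \<bar>d\<bar>"
proof -
  have "(h / d)\<^sup>2 - k / d = (h\<^sup>2 - d * k) / d\<^sup>2"
    using assms by (simp add: power2_eq_square field_simps)
  then show ?thesis by (simp add: real_sqrt_divide)
qed

section \<open>The compared conditions in terms of the sign of \<open>lambda_rel\<close>\<close>

context framed_surface
begin

lemma isCont_invariants:
  assumes "q \<in> U"
  shows "isCont (lambda_rel x \<Omega>) q" "isCont (K_rel \<Omega>) q" "isCont (H_rel x \<Omega>) q"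
    "isCont (k1_rel x \<Omega>) q" "isCont (k2_rel x \<Omega>) q"
proof -
  show *: "isCont (lambda_rel x \<Omega>) q" "isCont (K_rel \<Omega>) q" "isCont (H_rel x \<Omega>) q"
    using continuous_invariants open_U assms by (simp_all add: continuous_on_eq_continuous_at)
  show "isCont (k1_rel x \<Omega>) q" "isCont (k2_rel x \<Omega>) q"
    unfolding k1_rel_def[abs_def] k2_rel_def[abs_def] by (intro continuous_intros *)+
qed

text \<open>Extracting the denominator from the square root produces its absolute value; the case
  distinction on the sign of \<open>lambda_rel\<close> in \<open>k1\<close> and \<open>k2\<close>
  compensates for this.\<close>

lemma principal_curvatures:
  assumes "q \<in> U" and nz: "lambda_rel x \<Omega> q \<noteq> 0"
  shows "k1 x \<Omega> q = k1_rel x \<Omega> q / lambda_rel x \<Omega> q"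
    and "k2 x \<Omega> q = k2_rel x \<Omega> q / lambda_rel x \<Omega> q"
  unfolding k1_def k2_def k1_rel_def k2_rel_def Let_def curvatures[OF assms]
    sqrt_discriminant_divide[OF nz]
  using nz by (auto simp: diff_divide_distrib add_divide_distrib abs_if)

lemma parallelly_smoothable_iff:
  assumes p: "p \<in> U" "lambda_rel x \<Omega> p = 0" and H: "H_rel x \<Omega> p \<noteq> 0"
  shows "parallelly_smoothable_at U x \<Omega> p \<longleftrightarrow> no_sign_change_near U p (lambda_rel x \<Omega>)"
proof -
  have rank: "(\<forall>q\<in>V. \<forall>l\<in>L. rank (Dmat (\<lambda>r. x r + l *\<^sub>R \<nu> r) q) = 2) \<longleftrightarrow>
      (\<forall>q\<in>V. \<forall>l\<in>L. lambda_rel x \<Omega> q + l * (- 2 * H_rel x \<Omega> q) + l\<^sup>2 * K_rel \<Omega> q \<noteq> 0)"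
    if "V \<subseteq> U" for V L
    by (intro ball_cong refl rank_parallel_iff) (use that in auto)
  have "parallelly_smoothable_at U x \<Omega> p \<longleftrightarrow>
    (\<exists>\<epsilon>>0. \<exists>V. open V \<and> p \<in> V \<and> V \<subseteq> U \<and>
      ((\<forall>q\<in>V. \<forall>l\<in>{0<..<\<epsilon>}. lambda_rel x \<Omega> q + l * (- 2 * H_rel x \<Omega> q) + l\<^sup>2 * K_rel \<Omega> q \<noteq> 0) \<or>
       (\<forall>q\<in>V. \<forall>l\<in>{-\<epsilon><..<0}. lambda_rel x \<Omega> q + l * (- 2 * H_rel x \<Omega> q) + l\<^sup>2 * K_rel \<Omega> q \<noteq> 0)))"
    using p by (simp only: parallelly_smoothable_at_def singular_iff simp_thms rank cong: conj_cong)
  also have "\<dots> \<longleftrightarrow> no_sign_change_near U p (lambda_rel x \<Omega>)"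
    by (rule quadratic_nonzero_one_sided_iff)
       (use open_U p H isCont_invariants[OF p(1)] in \<open>auto intro!: continuous_intros\<close>)
  finally show ?thesis .
qed

lemma diverges_iff:
  assumes p: "p \<in> U" "lambda_rel x \<Omega> p = 0" and g: "isCont g p" "g p \<noteq> 0"
    and eq: "\<And>q. q \<in> U \<Longrightarrow> lambda_rel x \<Omega> q \<noteq> 0 \<Longrightarrow> \<phi> q = g q / lambda_rel x \<Omega> q"
  shows "diverges_at U x p \<phi> \<longleftrightarrow> no_sign_change_near U p (lambda_rel x \<Omega>)"
proof (rule diverges_at_quotient_iff[OF open_U p(1) isCont_invariants(1)[OF p(1)] p(2) g singular_iff])
  show "\<forall>\<^sub>F q in nhds p. lambda_rel x \<Omega> q \<noteq> 0 \<longrightarrow> \<phi> q = g q / lambda_rel x \<Omega> q"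
    using eventually_nhds_in_open[OF open_U p(1)] by eventually_elim (use eq in auto)
qed

text \<open>\<open>k\<^sub>1\<^sub>\<Omega> k\<^sub>2\<^sub>\<Omega> = \<lambda>\<^sub>\<Omega> K\<^sub>\<Omega>\<close> only where the discriminant is nonnegative, as \<open>sqrt\<close> is an odd function.\<close>

lemma rel_curvature_product_near:
  assumes p: "p \<in> U" "lambda_rel x \<Omega> p = 0" and H: "H_rel x \<Omega> p \<noteq> 0"
  shows "\<forall>\<^sub>F q in nhds p. k1_rel x \<Omega> q * k2_rel x \<Omega> q = lambda_rel x \<Omega> q * K_rel \<Omega> q"
proof -
  have "isCont (\<lambda>q. (H_rel x \<Omega> q)\<^sup>2 - lambda_rel x \<Omega> q * K_rel \<Omega> q) p"
    by (intro continuous_intros isCont_invariants p)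
  \<comment> \<open>At \<open>p\<close> the discriminant reduces to the square of
    \<open>H_rel\<close>, because \<open>lambda_rel\<close> vanishes there.\<close>
  then have "((\<lambda>q. (H_rel x \<Omega> q)\<^sup>2 - lambda_rel x \<Omega> q * K_rel \<Omega> q) \<longlongrightarrow> (H_rel x \<Omega> p)\<^sup>2) (nhds p)"
    using p(2) tendsto_nhds_iff by (force simp: isCont_def)
  from order_tendstoD(1)[OF this, of 0] H
  have "\<forall>\<^sub>F q in nhds p. 0 < (H_rel x \<Omega> q)\<^sup>2 - lambda_rel x \<Omega> q * K_rel \<Omega> q" by simp
  then show ?thesis
  proof eventually_elim
    case (elim q)
    then have "(sqrt ((H_rel x \<Omega> q)\<^sup>2 - lambda_rel x \<Omega> q * K_rel \<Omega> q))\<^sup>2 =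
        (H_rel x \<Omega> q)\<^sup>2 - lambda_rel x \<Omega> q * K_rel \<Omega> q" by simp
    then show ?case unfolding k1_rel_def k2_rel_def by algebra
  qed
qed

text \<open>Here \<open>g\<close> is the relative principal curvature that is nonzero at
  \<open>p\<close> and \<open>f\<close> the other one; near \<open>p\<close>, \<open>f\<close> is
  \<open>lambda_rel\<close> times the nonvanishing continuous factor
  \<open>K_rel / g\<close>.\<close>

lemma no_sign_change_cofactor:
  assumes p: "p \<in> U" and g: "isCont g p" "g p \<noteq> 0" and K: "K_rel \<Omega> p \<noteq> 0"
    and eq: "\<forall>\<^sub>F q in nhds p. g q * f q = lambda_rel x \<Omega> q * K_rel \<Omega> q"
  shows "no_sign_change_near U p f \<longleftrightarrow> no_sign_change_near U p (lambda_rel x \<Omega>)"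
proof (rule no_sign_change_near_mult[OF open_U p])
  have "\<forall>\<^sub>F q in nhds p. g q \<noteq> 0"
    using g by (intro tendsto_imp_eventually_ne[of g "g p"]) (simp_all add: isCont_def tendsto_nhds_iff)
  with eq show "\<forall>\<^sub>F q in nhds p. f q = lambda_rel x \<Omega> q * (K_rel \<Omega> q / g q)"
    by eventually_elim (simp add: field_simps)
  show "isCont (\<lambda>q. K_rel \<Omega> q / g q) p" by (intro continuous_intros isCont_invariants p g)
  show "K_rel \<Omega> p / g p \<noteq> 0" using K g by simp
qed

end

theorem theorem4p3:
  fixes U :: "(real^2) set"
    and x :: "real^2 \<Rightarrow> real^3"
    and \<Omega> :: "real^2 \<Rightarrow> real^2^3"
    and p :: "real^2"
  assumes "open U"
    and "wavefront U x"
    and "tangent_moving_basis U x \<Omega>"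
    and "p \<in> singular_set U x"
    and "rank (Dmat x p) = 1"
    and "K_rel \<Omega> p \<noteq> 0"
  shows "(H_rel x \<Omega> p < 0 \<longrightarrow>
            all_equivalent
              [parallelly_smoothable_at U x \<Omega> p,
               diverges_at U x p (mean_curv x \<Omega>),
               diverges_at U x p (k1 x \<Omega>),
               diverges_at U x p (gauss_curv x \<Omega>),
               no_sign_change_near U p (lambda_rel x \<Omega>),
               no_sign_change_near U p (k2_rel x \<Omega>)]) \<and>
         (H_rel x \<Omega> p > 0 \<longrightarrow>
            all_equivalent
              [parallelly_smoothable_at U x \<Omega> p,
               diverges_at U x p (mean_curv x \<Omega>),
               diverges_at U x p (k2 x \<Omega>),
               diverges_at U x p (gauss_curv x \<Omega>),
               no_sign_change_near U p (lambda_rel x \<Omega>),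
               no_sign_change_near U p (k1_rel x \<Omega>)])"
proof -
  interpret framed_surface U x \<Omega>
    using assms(1-3) by unfold_locales (auto simp: wavefront_def frontal_def)
  have p: "p \<in> U" using assms(4) by (simp add: singular_set_def)
  have l0: "lambda_rel x \<Omega> p = 0" using assms(4) singular_iff[OF p] by simp
  note cont = isCont_invariants[OF p]
  let ?l = "no_sign_change_near U p (lambda_rel x \<Omega>)"
  \<comment> \<open>Every condition is compared with the sign condition \<open>?l\<close> instead of
    with the others.\<close>
  have common: "parallelly_smoothable_at U x \<Omega> p \<longleftrightarrow> ?l"
    "diverges_at U x p (mean_curv x \<Omega>) \<longleftrightarrow> ?l" "diverges_at U x p (gauss_curv x \<Omega>) \<longleftrightarrow> ?l"
    if "H_rel x \<Omega> p \<noteq> 0"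
  proof -
    show "parallelly_smoothable_at U x \<Omega> p \<longleftrightarrow> ?l"
      by (rule parallelly_smoothable_iff[OF p l0 that])
    show "diverges_at U x p (mean_curv x \<Omega>) \<longleftrightarrow> ?l"
      by (rule diverges_iff[OF p l0 cont(3) that curvatures(2)])
    show "diverges_at U x p (gauss_curv x \<Omega>) \<longleftrightarrow> ?l"
      by (rule diverges_iff[OF p l0 cont(2) assms(6) curvatures(1)])
  qed
  show ?thesis
  proof (intro conjI impI)
    assume H: "H_rel x \<Omega> p < 0"
    \<comment> \<open>Since \<open>lambda_rel\<close> vanishes at \<open>p\<close>, the value is
      \<open>H - \<bar>H\<bar> = 2 * H\<close> for negative \<open>H\<close>.\<close>
    have k1: "k1_rel x \<Omega> p \<noteq> 0" using H l0 by (simp add: k1_rel_def)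
    have "diverges_at U x p (k1 x \<Omega>) \<longleftrightarrow> ?l"
      by (rule diverges_iff[OF p l0 cont(4) k1 principal_curvatures(1)])
    moreover have "no_sign_change_near U p (k2_rel x \<Omega>) \<longleftrightarrow> ?l"
      using H by (intro no_sign_change_cofactor[OF p cont(4) k1 assms(6)]
          rel_curvature_product_near p l0) simp
    ultimately show "all_equivalent
              [parallelly_smoothable_at U x \<Omega> p,
               diverges_at U x p (mean_curv x \<Omega>),
               diverges_at U x p (k1 x \<Omega>),
               diverges_at U x p (gauss_curv x \<Omega>),
               no_sign_change_near U p (lambda_rel x \<Omega>),
               no_sign_change_near U p (k2_rel x \<Omega>)]"
      using H by (simp add: all_equivalent_def common)
  next
    assume H: "H_rel x \<Omega> p > 0"
    \<comment> \<open>Now \<open>H + \<bar>H\<bar> = 2 * H\<close>, so the roles of the two relative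
      principal curvatures are exchanged.\<close>
    have k2: "k2_rel x \<Omega> p \<noteq> 0" using H l0 by (simp add: k2_rel_def)
    have "diverges_at U x p (k2 x \<Omega>) \<longleftrightarrow> ?l"
      by (rule diverges_iff[OF p l0 cont(5) k2 principal_curvatures(2)])
    moreover have "no_sign_change_near U p (k1_rel x \<Omega>) \<longleftrightarrow> ?l"
    proof (rule no_sign_change_cofactor[OF p cont(5) k2 assms(6)])
      show "\<forall>\<^sub>F q in nhds p. k2_rel x \<Omega> q * k1_rel x \<Omega> q = lambda_rel x \<Omega> q * K_rel \<Omega> q"
        using rel_curvature_product_near[OF p l0] H by (simp add: mult.commute)
    qed
    ultimately show "all_equivalent
              [parallelly_smoothable_at U x \<Omega> p,
               diverges_at U x p (mean_curv x \<Omega>),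
               diverges_at U x p (k2 x \<Omega>),
               diverges_at U x p (gauss_curv x \<Omega>),
               no_sign_change_near U p (lambda_rel x \<Omega>),
               no_sign_change_near U p (k1_rel x \<Omega>)]"
      using H by (simp add: all_equivalent_def common)
  qed
qed

end
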